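(* Consider $H=H(G,\chi,\eta,b,c,0)$ with $G$ finitely generated abelian. Suppose $q=\eta(b)$ is a primitive $n$th root of unity and $\mathrm{Im}(\eta)=\langle q\rangle$. Let $V$ be a $y$-torsion-free, $x$-torsion simple $H$-module. Then there exist $(\alpha,\lambda)\in\mathbb{K}^\times\times\widehat{N}_y$ with $N_y=\ker(\eta)$ such that $V$ has a $\mathbb{K}$-basis $\{v_0,\ldots,v_{n-1}\}$ with $$x\cdot v_i=0,\qquad y\cdot v_i=q^i\alpha v_i,\qquad h\cdot v_i=\lambda(h)v_i,$$ and $$b\cdot v_i=\begin{cases}\lambda(b^n)v_0&\text{if }i=n-1,\\ v_{i+1}&\text{otherwise,}\end{cases}$$ for all $0\le i\le n-1$ and $h\in N_y$. Denote this module by $V_y(\alpha,\lambda)$. Moreover, $V_y(\alpha,\lambda)\simeq V_y(\alpha',\lambda')$ if and only if $\lambda=\lambda'$ and $\alpha=q^i\alpha'$ for some $i$.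
   Context: $\mathbb{K}$ is an algebraically closed field of characteristic zero; $\widehat{G}$ is the group of homomorphisms $G\to\mathbb{K}^\times$ (similarly $\widehat{N}_y$). $G$ is a finitely generated abelian group, $b,c\in G$, and $\chi,\eta\in\widehat{G}$ have finite order and satisfy $\eta(b)=\chi(c)^{-1}$. The Hopf algebra $H(G,\chi,\eta,b,c,0)$ is written, after replacing its second Ore variable $y$ by $c^{-1}y$, as the skew group ring $\mathbb{K}[x,y]\#G$: it is generated by $G,x,y$ with $xy=yx$, $xg=\chi(g)gx$, $yg=\eta(g)gy$ for $g\in G$, and has $\mathbb{K}$-basis $\{x^iy^jg\mid i,j\ge 0,\ g\in G\}$ (elements of $G$ group-like, $\Delta(x)=x\otimes1+b\otimes x$, $\Delta(y)=y\otimes c^{-1}+1\otimes y$). A module $M$ is $x$-torsion if each $m\in M$ is killed by some $x^k$, $k\ge1$, and $x$-torsion-free if no nonzero $m\in M$ is killed by a power of $x$; similarly for $y$. *)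

theory Defs
  imports
    "HOL-Algebra.Algebra"
    "HOL-Library.Poly_Mapping"
    "HOL-Library.FuncSet"
    "HOL-Computational_Algebra.Polynomial"
begin

section \<open>Characters\<close>

definition Kx :: "'k::field monoid" where
  "Kx = \<lparr>carrier = {a. a \<noteq> 0}, monoid.mult = (*), one = 1\<rparr>"

text \<open>The group of homomorphisms \<open>G \<rightarrow> K\<^sup>\<times>\<close> is \<^term>\<open>hom G Kx\<close>. Values outside
  \<^term>\<open>carrier G\<close> are irrelevant: equality of characters means agreement on \<^term>\<open>carrier G\<close>.\<close>

lemma Kx_simps [simp]: "carrier Kx = {a. a \<noteq> 0}" "a \<otimes>\<^bsub>Kx\<^esub> b = a * b" "\<one>\<^bsub>Kx\<^esub> = 1"
  by (simp_all add: Kx_def)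

lemma group_Kx: "comm_group (Kx :: 'k::field monoid)"
  by (rule comm_groupI) (auto simp: ac_simps intro!: exI[of _ "inverse _"])

lemma char_mult: "\<lbrakk>\<chi> \<in> hom G Kx; g \<in> carrier G; h \<in> carrier G\<rbrakk> \<Longrightarrow> \<chi> (g \<otimes>\<^bsub>G\<^esub> h) = \<chi> g * \<chi> h"
  by (simp add: hom_def)

lemma char_nonzero: "\<lbrakk>\<chi> \<in> hom G Kx; g \<in> carrier G\<rbrakk> \<Longrightarrow> \<chi> g \<noteq> 0"
  by (auto simp: hom_def Pi_def)

lemma char_one: "\<lbrakk>\<chi> \<in> hom G (Kx :: 'k::field monoid); group G\<rbrakk> \<Longrightarrow> \<chi> \<one>\<^bsub>G\<^esub> = 1"
  using hom_one[of \<chi> G Kx] group_Kx[where ?'k='k] by (simp add: comm_group_def)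

definition finite_order_char :: "('g, 'm) monoid_scheme \<Rightarrow> ('g \<Rightarrow> 'k::field) \<Rightarrow> bool" where
  "finite_order_char G \<chi> \<longleftrightarrow> (\<exists>m::nat. m > 0 \<and> (\<forall>g\<in>carrier G. \<chi> g ^ m = 1))"

definition is_primitive_root :: "nat \<Rightarrow> 'k::field \<Rightarrow> bool" where
  "is_primitive_root n q \<longleftrightarrow> n > 0 \<and> q ^ n = 1 \<and> (\<forall>k. 0 < k \<and> k < n \<longrightarrow> q ^ k \<noteq> 1)"

definition finitely_generated_group :: "('g, 'm) monoid_scheme \<Rightarrow> bool" where
  "finitely_generated_group G \<longleftrightarrow> (\<exists>S. finite S \<and> S \<subseteq> carrier G \<and> generate G S = carrier G)"

section \<open>The skew group ring\<close>

text \<open>An element of \<open>K[x,y]#G\<close> is a finitely supported family of coefficients with respect to the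
  basis \<open>x\<^sup>i y\<^sup>j g\<close>, which is indexed by the triples \<open>(i, j, g)\<close>. Since \<open>xg = \<chi>(g)gx\<close> and
  \<open>yg = \<eta>(g)gy\<close>, one has
  \<open>(x\<^sup>i y\<^sup>j g) (x\<^sup>k y\<^sup>l h) = \<chi>(g)\<^bsup>-k\<^esup> \<eta>(g)\<^bsup>-l\<^esup> x\<^bsup>i+k\<^esup> y\<^bsup>j+l\<^esup> gh\<close>.

  This is the algebra underlying the Hopf algebra \<open>H(G,\<chi>,\<eta>,b,c,0)\<close>, with \<open>c\<^bsup>-1\<^esup>y\<close> written
  as \<open>y\<close>. The elements \<open>b\<close> and \<open>c\<close> enter only the coproduct and antipode,
  which play no role for modules.\<close>

type_synonym ('g, 'k) skew = "(nat \<times> nat \<times> 'g) \<Rightarrow>\<^sub>0 'k"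

fun basis_mult :: "('g, 'm) monoid_scheme \<Rightarrow> nat \<times> nat \<times> 'g \<Rightarrow> nat \<times> nat \<times> 'g \<Rightarrow> nat \<times> nat \<times> 'g" where
  "basis_mult G (i, j, g) (k, l, h) = (i + k, j + l, g \<otimes>\<^bsub>G\<^esub> h)"

fun twist :: "('g \<Rightarrow> 'k::field) \<Rightarrow> ('g \<Rightarrow> 'k) \<Rightarrow> nat \<times> nat \<times> 'g \<Rightarrow> nat \<times> nat \<times> 'g \<Rightarrow> 'k" where
  "twist \<chi> \<eta> (i, j, g) (k, l, h) = inverse (\<chi> g) ^ k * inverse (\<eta> g) ^ l"

definition skew_mult ::
  "('g, 'm) monoid_scheme \<Rightarrow> ('g \<Rightarrow> 'k::field) \<Rightarrow> ('g \<Rightarrow> 'k) \<Rightarrow> ('g, 'k) skew \<Rightarrow> ('g, 'k) skew \<Rightarrow> ('g, 'k) skew"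
  where
  "skew_mult G \<chi> \<eta> f f' =
     (\<Sum>p\<in>Poly_Mapping.keys f. \<Sum>p'\<in>Poly_Mapping.keys f'.
        Poly_Mapping.single (basis_mult G p p') (twist \<chi> \<eta> p p' * Poly_Mapping.lookup f p * Poly_Mapping.lookup f' p'))"

definition skew_ring ::
  "('g, 'm) monoid_scheme \<Rightarrow> ('g \<Rightarrow> 'k::field) \<Rightarrow> ('g \<Rightarrow> 'k) \<Rightarrow> ('g, 'k) skew ring" where
  "skew_ring G \<chi> \<eta> =
     \<lparr>carrier = {f. Poly_Mapping.keys f \<subseteq> UNIV \<times> UNIV \<times> carrier G},
      monoid.mult = skew_mult G \<chi> \<eta>,
      one = Poly_Mapping.single (0, 0, \<one>\<^bsub>G\<^esub>) 1,
      ring.zero = 0,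
      ring.add = (+)\<rparr>"

definition elt_x :: "('g, 'm) monoid_scheme \<Rightarrow> ('g, 'k::field) skew" where
  "elt_x G = Poly_Mapping.single (1, 0, \<one>\<^bsub>G\<^esub>) 1"

definition elt_y :: "('g, 'm) monoid_scheme \<Rightarrow> ('g, 'k::field) skew" where
  "elt_y G = Poly_Mapping.single (0, 1, \<one>\<^bsub>G\<^esub>) 1"

definition elt_grp :: "'g \<Rightarrow> ('g, 'k::field) skew" where
  "elt_grp g = Poly_Mapping.single (0, 0, g) 1"

definition elt_scalar :: "('g, 'm) monoid_scheme \<Rightarrow> 'k::field \<Rightarrow> ('g, 'k) skew" where
  "elt_scalar G a = Poly_Mapping.single (0, 0, \<one>\<^bsub>G\<^esub>) a"

lemma skew_mult_superset:
  assumes "finite A" "finite B" "Poly_Mapping.keys f \<subseteq> A" "Poly_Mapping.keys f' \<subseteq> B"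
  shows "skew_mult G \<chi> \<eta> f f' =
     (\<Sum>p\<in>A. \<Sum>p'\<in>B.
        Poly_Mapping.single (basis_mult G p p') (twist \<chi> \<eta> p p' * Poly_Mapping.lookup f p * Poly_Mapping.lookup f' p'))"
proof -
  have "(\<Sum>p'\<in>B. Poly_Mapping.single (basis_mult G p p') (twist \<chi> \<eta> p p' * Poly_Mapping.lookup f p * Poly_Mapping.lookup f' p'))
    = (\<Sum>p'\<in>Poly_Mapping.keys f'. Poly_Mapping.single (basis_mult G p p') (twist \<chi> \<eta> p p' * Poly_Mapping.lookup f p * Poly_Mapping.lookup f' p'))" for p
    by (rule sum.mono_neutral_right) (use assms in \<open>auto simp: in_keys_iff\<close>)
  then show ?thesis unfolding skew_mult_def
    by (simp, intro sum.mono_neutral_left) (use assms in \<open>auto simp: in_keys_iff\<close>)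
qed

lemma skew_mult_add_left: "skew_mult G \<chi> \<eta> (f + f') h = skew_mult G \<chi> \<eta> f h + skew_mult G \<chi> \<eta> f' h"
  by (subst (1 2 3) skew_mult_superset[where A = "Poly_Mapping.keys f \<union> Poly_Mapping.keys f'" and B = "Poly_Mapping.keys h"])
     (use keys_add[of f f'] in \<open>auto simp: lookup_add ring_distribs single_add sum.distrib\<close>)

lemma skew_mult_add_right: "skew_mult G \<chi> \<eta> h (f + f') = skew_mult G \<chi> \<eta> h f + skew_mult G \<chi> \<eta> h f'"
  by (subst (1 2 3) skew_mult_superset[where B = "Poly_Mapping.keys f \<union> Poly_Mapping.keys f'" and A = "Poly_Mapping.keys h"])
     (use keys_add[of f f'] in \<open>auto simp: lookup_add ring_distribs single_add sum.distrib\<close>)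

lemma skew_mult_zero [simp]: "skew_mult G \<chi> \<eta> 0 f = 0" "skew_mult G \<chi> \<eta> f 0 = 0"
  by (simp_all add: skew_mult_def)

lemma skew_mult_sum_left: "skew_mult G \<chi> \<eta> (\<Sum>i\<in>I. F i) h = (\<Sum>i\<in>I. skew_mult G \<chi> \<eta> (F i) h)"
  by (induction I rule: infinite_finite_induct) (simp_all add: skew_mult_add_left)

lemma skew_mult_sum_right: "skew_mult G \<chi> \<eta> h (\<Sum>i\<in>I. F i) = (\<Sum>i\<in>I. skew_mult G \<chi> \<eta> h (F i))"
  by (induction I rule: infinite_finite_induct) (simp_all add: skew_mult_add_right)

lemma skew_mult_single:
  "skew_mult G \<chi> \<eta> (Poly_Mapping.single p a) (Poly_Mapping.single p' a') = Poly_Mapping.single (basis_mult G p p') (twist \<chi> \<eta> p p' * a * a')"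
  by (subst skew_mult_superset[where A = "{p}" and B = "{p'}"]) auto

lemma skew_expand: "f = (\<Sum>p\<in>Poly_Mapping.keys f. Poly_Mapping.single p (Poly_Mapping.lookup f p))"
  by (rule poly_mapping_eqI) (auto simp: lookup_sum lookup_single when_def in_keys_iff)

lemma basis_twist_assoc:
  fixes \<chi> \<eta> :: "'g \<Rightarrow> 'k::field"
  assumes "group G" "\<chi> \<in> hom G Kx" "\<eta> \<in> hom G Kx"
    "p \<in> UNIV \<times> UNIV \<times> carrier G" "p' \<in> UNIV \<times> UNIV \<times> carrier G" "p'' \<in> UNIV \<times> UNIV \<times> carrier G"
  shows "basis_mult G (basis_mult G p p') p'' = basis_mult G p (basis_mult G p' p'')"
    "twist \<chi> \<eta> (basis_mult G p p') p'' * twist \<chi> \<eta> p p' = twist \<chi> \<eta> p (basis_mult G p' p'') * twist \<chi> \<eta> p' p''"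
proof -
  interpret group G by fact
  show "basis_mult G (basis_mult G p p') p'' = basis_mult G p (basis_mult G p' p'')"
    using assms(4-6) by (cases p; cases p'; cases p'') (auto simp: m_assoc)
  show "twist \<chi> \<eta> (basis_mult G p p') p'' * twist \<chi> \<eta> p p' = twist \<chi> \<eta> p (basis_mult G p' p'') * twist \<chi> \<eta> p' p''"
    using assms(2-6)
    by (cases p; cases p'; cases p'')
       (auto simp: char_mult power_add power_mult_distrib inverse_mult_distrib ac_simps)
qed

lemma skew_mult_closed:
  assumes "group G" "Poly_Mapping.keys f \<subseteq> UNIV \<times> UNIV \<times> carrier G" "Poly_Mapping.keys f' \<subseteq> UNIV \<times> UNIV \<times> carrier G"
  shows "Poly_Mapping.keys (skew_mult G \<chi> \<eta> f f') \<subseteq> UNIV \<times> UNIV \<times> carrier G"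
proof -
  interpret group G by fact
  have "Poly_Mapping.lookup (skew_mult G \<chi> \<eta> f f') (i, j, g) = 0" if "g \<notin> carrier G" for i j g
    unfolding skew_mult_def lookup_sum
  proof (intro sum.neutral ballI)
    fix p p' assume "p \<in> Poly_Mapping.keys f" "p' \<in> Poly_Mapping.keys f'"
    then have "p \<in> UNIV \<times> UNIV \<times> carrier G" "p' \<in> UNIV \<times> UNIV \<times> carrier G" using assms by auto
    then have "basis_mult G p p' \<noteq> (i, j, g)" using that by (cases p; cases p') auto
    then show "Poly_Mapping.lookup (Poly_Mapping.single (basis_mult G p p') (twist \<chi> \<eta> p p' * Poly_Mapping.lookup f p * Poly_Mapping.lookup f' p')) (i, j, g) = 0"
      by (simp add: lookup_single when_def)
  qed
  then show ?thesis by (auto simp: in_keys_iff)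
qed

lemma skew_mult_assoc:
  fixes \<chi> \<eta> :: "'g \<Rightarrow> 'k::field"
  assumes "group G" "\<chi> \<in> hom G Kx" "\<eta> \<in> hom G Kx"
    "Poly_Mapping.keys f \<subseteq> UNIV \<times> UNIV \<times> carrier G" "Poly_Mapping.keys f' \<subseteq> UNIV \<times> UNIV \<times> carrier G"
    "Poly_Mapping.keys f'' \<subseteq> UNIV \<times> UNIV \<times> carrier G"
  shows "skew_mult G \<chi> \<eta> (skew_mult G \<chi> \<eta> f f') f'' = skew_mult G \<chi> \<eta> f (skew_mult G \<chi> \<eta> f' f'')"
proof -
  have *: "skew_mult G \<chi> \<eta> (skew_mult G \<chi> \<eta> (Poly_Mapping.single p a) (Poly_Mapping.single p' a')) (Poly_Mapping.single p'' a'')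
      = skew_mult G \<chi> \<eta> (Poly_Mapping.single p a) (skew_mult G \<chi> \<eta> (Poly_Mapping.single p' a') (Poly_Mapping.single p'' a''))"
    if "p \<in> Poly_Mapping.keys f" "p' \<in> Poly_Mapping.keys f'" "p'' \<in> Poly_Mapping.keys f''" for p p' p'' a a' a''
  proof -
    have m: "p \<in> UNIV \<times> UNIV \<times> carrier G" "p' \<in> UNIV \<times> UNIV \<times> carrier G" "p'' \<in> UNIV \<times> UNIV \<times> carrier G"
      using that assms by auto
    note t = basis_twist_assoc[OF assms(1-3) m]
    have "twist \<chi> \<eta> (basis_mult G p p') p'' * (twist \<chi> \<eta> p p' * a * a') * a''
        = (twist \<chi> \<eta> (basis_mult G p p') p'' * twist \<chi> \<eta> p p') * (a * a' * a'')" by (simp add: ac_simps)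
    also have "\<dots> = twist \<chi> \<eta> p (basis_mult G p' p'') * a * (twist \<chi> \<eta> p' p'' * a' * a'')"
      unfolding t(2) by (simp add: ac_simps)
    finally show ?thesis by (simp only: skew_mult_single t(1))
  qed
  show ?thesis
    by (subst (1 2) skew_expand[of f], subst (1 2) skew_expand[of f'], subst (1 2) skew_expand[of f''])
       (simp only: skew_mult_sum_left skew_mult_sum_right, intro sum.cong refl *)
qed

lemma ring_skew_ring:
  fixes \<chi> \<eta> :: "'g \<Rightarrow> 'k::field"
  assumes "group G" "\<chi> \<in> hom G Kx" "\<eta> \<in> hom G Kx"
  shows "ring (skew_ring G \<chi> \<eta>)"
proof -
  interpret group G by fact
  have one: "skew_mult G \<chi> \<eta> (Poly_Mapping.single (0, 0, \<one>\<^bsub>G\<^esub>) 1) f = f"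
    "skew_mult G \<chi> \<eta> f (Poly_Mapping.single (0, 0, \<one>\<^bsub>G\<^esub>) 1) = f"
    if "Poly_Mapping.keys f \<subseteq> UNIV \<times> UNIV \<times> carrier G" for f :: "('g, 'k) skew"
  proof -
    have "skew_mult G \<chi> \<eta> (Poly_Mapping.single (0, 0, \<one>\<^bsub>G\<^esub>) 1) (Poly_Mapping.single p a) = Poly_Mapping.single p a \<and> skew_mult G \<chi> \<eta> (Poly_Mapping.single p a) (Poly_Mapping.single (0, 0, \<one>\<^bsub>G\<^esub>) 1) = Poly_Mapping.single p a"
      if "p \<in> Poly_Mapping.keys f" for p a
      using that \<open>Poly_Mapping.keys f \<subseteq> _\<close> assms
      by (cases p) (auto simp: skew_mult_single char_one[OF _ assms(1)])
    then show "skew_mult G \<chi> \<eta> (Poly_Mapping.single (0, 0, \<one>\<^bsub>G\<^esub>) 1) f = f"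
      "skew_mult G \<chi> \<eta> f (Poly_Mapping.single (0, 0, \<one>\<^bsub>G\<^esub>) 1) = f"
      by (subst (1 2) skew_expand[of f], simp add: skew_mult_sum_left skew_mult_sum_right)+
  qed
  show ?thesis
  proof (rule ringI)
    show "abelian_group (skew_ring G \<chi> \<eta>)"
    proof (rule abelian_groupI)
      show "\<exists>y\<in>carrier (skew_ring G \<chi> \<eta>). y \<oplus>\<^bsub>skew_ring G \<chi> \<eta>\<^esub> x = \<zero>\<^bsub>skew_ring G \<chi> \<eta>\<^esub>"
        if "x \<in> carrier (skew_ring G \<chi> \<eta>)" for x
        using that by (intro bexI[of _ "-x"]) (auto simp: skew_ring_def in_keys_iff)
    qed (use keys_add in \<open>fastforce simp: skew_ring_def ac_simps\<close>)+
    show "Group.monoid (skew_ring G \<chi> \<eta>)"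
      by (rule monoidI)
         (use skew_mult_closed[OF assms(1), THEN subsetD] skew_mult_assoc[OF assms] one in \<open>auto simp: skew_ring_def\<close>)
  qed (simp_all add: skew_ring_def skew_mult_add_left skew_mult_add_right)
qed

lemma skew_ring_relations:
  assumes "group G" "\<chi> \<in> hom G Kx" "\<eta> \<in> hom G Kx" "g \<in> carrier G" "h \<in> carrier G"
  defines "H \<equiv> skew_ring G \<chi> \<eta>"
  shows "elt_x G \<otimes>\<^bsub>H\<^esub> elt_y G = elt_y G \<otimes>\<^bsub>H\<^esub> elt_x G"
    and "elt_x G \<otimes>\<^bsub>H\<^esub> elt_grp g = elt_scalar G (\<chi> g) \<otimes>\<^bsub>H\<^esub> (elt_grp g \<otimes>\<^bsub>H\<^esub> elt_x G)"
    and "elt_y G \<otimes>\<^bsub>H\<^esub> elt_grp g = elt_scalar G (\<eta> g) \<otimes>\<^bsub>H\<^esub> (elt_grp g \<otimes>\<^bsub>H\<^esub> elt_y G)"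
    and "elt_grp g \<otimes>\<^bsub>H\<^esub> elt_grp h = elt_grp (g \<otimes>\<^bsub>G\<^esub> h)"
    and "Poly_Mapping.single (i, j, g) a =
      elt_scalar G a \<otimes>\<^bsub>H\<^esub> (elt_x G [^]\<^bsub>H\<^esub> i \<otimes>\<^bsub>H\<^esub> (elt_y G [^]\<^bsub>H\<^esub> j \<otimes>\<^bsub>H\<^esub> elt_grp g))"
proof -
  interpret group G by fact
  note simps = H_def skew_ring_def elt_x_def elt_y_def elt_grp_def elt_scalar_def skew_mult_single
    char_one[OF _ assms(1)] char_nonzero
  show "elt_x G \<otimes>\<^bsub>H\<^esub> elt_y G = elt_y G \<otimes>\<^bsub>H\<^esub> elt_x G"
    "elt_x G \<otimes>\<^bsub>H\<^esub> elt_grp g = elt_scalar G (\<chi> g) \<otimes>\<^bsub>H\<^esub> (elt_grp g \<otimes>\<^bsub>H\<^esub> elt_x G)"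
    "elt_y G \<otimes>\<^bsub>H\<^esub> elt_grp g = elt_scalar G (\<eta> g) \<otimes>\<^bsub>H\<^esub> (elt_grp g \<otimes>\<^bsub>H\<^esub> elt_y G)"
    "elt_grp g \<otimes>\<^bsub>H\<^esub> elt_grp h = elt_grp (g \<otimes>\<^bsub>G\<^esub> h)"
    using assms(2-5) by (simp_all add: simps)
  have "elt_x G [^]\<^bsub>H\<^esub> i = Poly_Mapping.single (i, 0, \<one>\<^bsub>G\<^esub>) 1"
    by (induction i) (use assms(2,3) in \<open>simp_all add: simps nat_pow_def\<close>)
  moreover have "elt_y G [^]\<^bsub>H\<^esub> j = Poly_Mapping.single (0, j, \<one>\<^bsub>G\<^esub>) 1"
    by (induction j) (use assms(2,3) in \<open>simp_all add: simps nat_pow_def\<close>)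
  ultimately show "Poly_Mapping.single (i, j, g) a =
      elt_scalar G a \<otimes>\<^bsub>H\<^esub> (elt_x G [^]\<^bsub>H\<^esub> i \<otimes>\<^bsub>H\<^esub> (elt_y G [^]\<^bsub>H\<^esub> j \<otimes>\<^bsub>H\<^esub> elt_grp g))"
    using assms(2-5) by (simp add: simps)
qed

section \<open>Modules over noncommutative rings\<close>

text \<open>The locale \<^locale>\<open>module\<close> is restricted to commutative rings. In the record
  type of modules, only the components \<^const>\<open>carrier\<close>, \<^const>\<open>ring.add\<close>, \<^const>\<open>ring.zero\<close>, \<^const>\<open>module.smult\<close>
  are relevant.\<close>

locale left_module = R?: ring R + M?: abelian_group M
  for R :: "('a, 'c) ring_scheme" (structure) and M :: "('a, 'b, 'd) module_scheme" (structure) +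
  assumes smult_closed:
      "\<lbrakk>a \<in> carrier R; m \<in> carrier M\<rbrakk> \<Longrightarrow> a \<odot>\<^bsub>M\<^esub> m \<in> carrier M"
    and smult_l_distr:
      "\<lbrakk>a \<in> carrier R; a' \<in> carrier R; m \<in> carrier M\<rbrakk> \<Longrightarrow>
        (a \<oplus> a') \<odot>\<^bsub>M\<^esub> m = a \<odot>\<^bsub>M\<^esub> m \<oplus>\<^bsub>M\<^esub> a' \<odot>\<^bsub>M\<^esub> m"
    and smult_r_distr:
      "\<lbrakk>a \<in> carrier R; m \<in> carrier M; m' \<in> carrier M\<rbrakk> \<Longrightarrow>
        a \<odot>\<^bsub>M\<^esub> (m \<oplus>\<^bsub>M\<^esub> m') = a \<odot>\<^bsub>M\<^esub> m \<oplus>\<^bsub>M\<^esub> a \<odot>\<^bsub>M\<^esub> m'"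
    and smult_assoc:
      "\<lbrakk>a \<in> carrier R; a' \<in> carrier R; m \<in> carrier M\<rbrakk> \<Longrightarrow>
        (a \<otimes> a') \<odot>\<^bsub>M\<^esub> m = a \<odot>\<^bsub>M\<^esub> (a' \<odot>\<^bsub>M\<^esub> m)"
    and smult_one:
      "m \<in> carrier M \<Longrightarrow> \<one> \<odot>\<^bsub>M\<^esub> m = m"

definition simple_left_module :: "('a, 'c) ring_scheme \<Rightarrow> ('a, 'b, 'd) module_scheme \<Rightarrow> bool" where
  "simple_left_module R M \<longleftrightarrow>
     left_module R M \<and> carrier M \<noteq> {\<zero>\<^bsub>M\<^esub>} \<and>
     (\<forall>N. submodule N R M \<longrightarrow> N = {\<zero>\<^bsub>M\<^esub>} \<or> N = carrier M)"

definition left_modules_isomorphic ::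
  "('a, 'c) ring_scheme \<Rightarrow> ('a, 'b, 'd) module_scheme \<Rightarrow> ('a, 'b', 'd') module_scheme \<Rightarrow> bool" where
  "left_modules_isomorphic R M M' \<longleftrightarrow>
     (\<exists>f \<in> iso (add_monoid M) (add_monoid M').
        \<forall>a\<in>carrier R. \<forall>m\<in>carrier M. f (a \<odot>\<^bsub>M\<^esub> m) = a \<odot>\<^bsub>M'\<^esub> f m)"

definition torsion_wrt :: "('a, 'c) ring_scheme \<Rightarrow> 'a \<Rightarrow> ('a, 'b, 'd) module_scheme \<Rightarrow> bool" where
  "torsion_wrt R z M \<longleftrightarrow>
     (\<forall>m\<in>carrier M. \<exists>k::nat. k \<ge> 1 \<and> (z [^]\<^bsub>R\<^esub> k) \<odot>\<^bsub>M\<^esub> m = \<zero>\<^bsub>M\<^esub>)"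

definition torsion_free_wrt :: "('a, 'c) ring_scheme \<Rightarrow> 'a \<Rightarrow> ('a, 'b, 'd) module_scheme \<Rightarrow> bool" where
  "torsion_free_wrt R z M \<longleftrightarrow>
     (\<forall>m\<in>carrier M. (\<exists>k::nat. k \<ge> 1 \<and> (z [^]\<^bsub>R\<^esub> k) \<odot>\<^bsub>M\<^esub> m = \<zero>\<^bsub>M\<^esub>) \<longrightarrow> m = \<zero>\<^bsub>M\<^esub>)"

section \<open>The modules \<open>V\<^sub>y(\<alpha>,\<lambda>)\<close>\<close>

text \<open>The character \<open>\<lambda>\<close> of \<open>ker \<eta>\<close> is written \<open>\<mu>\<close>, since \<open>\<lambda>\<close> is reserved.\<close>

text \<open>\<open>v 0, \<dots>, v (n - 1)\<close> is a \<open>K\<close>-basis: every element is a unique \<open>K\<close>-linear combination.\<close>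

definition K_basis ::
  "('g, 'm) monoid_scheme \<Rightarrow> (('g, 'k::field) skew, 'v, 'd) module_scheme \<Rightarrow> nat \<Rightarrow> (nat \<Rightarrow> 'v) \<Rightarrow> bool"
  where
  "K_basis G M n v \<longleftrightarrow>
     v \<in> {..<n} \<rightarrow> carrier M \<and>
     (\<forall>m\<in>carrier M. \<exists>!a. a \<in> {..<n} \<rightarrow>\<^sub>E UNIV \<and>
        m = (\<Oplus>\<^bsub>M\<^esub>i\<in>{..<n}. elt_scalar G (a i) \<odot>\<^bsub>M\<^esub> v i))"

definition is_V_y ::
  "('g, 'm) monoid_scheme \<Rightarrow> ('g \<Rightarrow> 'k::field) \<Rightarrow> ('g \<Rightarrow> 'k) \<Rightarrow> 'g \<Rightarrow> nat \<Rightarrow> 'k \<Rightarrow> ('g \<Rightarrow> 'k) \<Rightarrow>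
     (('g, 'k) skew, 'v, 'd) module_scheme \<Rightarrow> bool" where
  "is_V_y G \<chi> \<eta> b n \<alpha> \<mu> M \<longleftrightarrow>
     left_module (skew_ring G \<chi> \<eta>) M \<and>
     (\<exists>v. K_basis G M n v \<and>
       (\<forall>i<n.
          elt_x G \<odot>\<^bsub>M\<^esub> v i = \<zero>\<^bsub>M\<^esub> \<and>
          elt_y G \<odot>\<^bsub>M\<^esub> v i = elt_scalar G (\<eta> b ^ i * \<alpha>) \<odot>\<^bsub>M\<^esub> v i \<and>
          (\<forall>h\<in>kernel G Kx \<eta>. elt_grp h \<odot>\<^bsub>M\<^esub> v i = elt_scalar G (\<mu> h) \<odot>\<^bsub>M\<^esub> v i) \<and>
          elt_grp b \<odot>\<^bsub>M\<^esub> v i =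
            (if i = n - 1 then elt_scalar G (\<mu> (b [^]\<^bsub>G\<^esub> n)) \<odot>\<^bsub>M\<^esub> v 0 else v (i + 1))))"

text \<open>For every \<open>\<alpha>\<close> and \<open>\<mu>\<close> there is a module satisfying \<^const>\<open>is_V_y\<close>, namely the one
  coinduced from the one-dimensional \<open>K[x,y]#ker \<eta>\<close>-module on which \<open>x\<close>, \<open>y\<close> and
  \<open>h \<in> ker \<eta>\<close> act by \<open>0\<close>, \<open>\<alpha>\<close> and \<open>\<mu> h\<close>: it consists of the functions \<open>f\<close> on \<open>G\<close>
  with \<open>f (h u) = \<mu> h f u\<close>, on which \<open>g\<close> acts by right translation and \<open>y\<close> by
  multiplication with \<open>\<alpha> \<eta>(u)\<^bsup>-1\<^esup>\<close>.\<close>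

definition V_y_model ::
  "('g, 'm) monoid_scheme \<Rightarrow> ('g \<Rightarrow> 'k::field) \<Rightarrow> 'k \<Rightarrow> ('g \<Rightarrow> 'k) \<Rightarrow> (('g, 'k) skew, 'g \<Rightarrow> 'k) module" where
  "V_y_model G \<eta> \<alpha> \<mu> =
     \<lparr>carrier = {f. (\<forall>u. u \<notin> carrier G \<longrightarrow> f u = 0) \<and>
                  (\<forall>h\<in>kernel G Kx \<eta>. \<forall>u\<in>carrier G. f (h \<otimes>\<^bsub>G\<^esub> u) = \<mu> h * f u)},
      monoid.mult = undefined, one = undefined,
      ring.zero = (\<lambda>u. 0), ring.add = (\<lambda>f f' u. f u + f' u),
      module.smult = (\<lambda>p f u. if u \<in> carrier G
                 then \<Sum>(i, j, g)\<in>Poly_Mapping.keys p.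
                   Poly_Mapping.lookup p (i, j, g) * 0 ^ i * (\<alpha> * inverse (\<eta> u)) ^ j * f (u \<otimes>\<^bsub>G\<^esub> g)
                 else 0)\<rparr>"

lemma V_y_model_smult_superset:
  assumes "finite A" "Poly_Mapping.keys p \<subseteq> A" "u \<in> carrier G"
  shows "(p \<odot>\<^bsub>V_y_model G \<eta> \<alpha> \<mu>\<^esub> f) u = (\<Sum>(i, j, g)\<in>A.
     Poly_Mapping.lookup p (i, j, g) * 0 ^ i * (\<alpha> * inverse (\<eta> u)) ^ j * f (u \<otimes>\<^bsub>G\<^esub> g))"
  using assms by (auto simp: V_y_model_def in_keys_iff intro!: sum.mono_neutral_left)

lemma V_y_model_smult_add:
  "(p + p') \<odot>\<^bsub>V_y_model G \<eta> \<alpha> \<mu>\<^esub> f = (\<lambda>u. (p \<odot>\<^bsub>V_y_model G \<eta> \<alpha> \<mu>\<^esub> f) u + (p' \<odot>\<^bsub>V_y_model G \<eta> \<alpha> \<mu>\<^esub> f) u)"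
proof
  fix u
  show "((p + p') \<odot>\<^bsub>V_y_model G \<eta> \<alpha> \<mu>\<^esub> f) u = (p \<odot>\<^bsub>V_y_model G \<eta> \<alpha> \<mu>\<^esub> f) u + (p' \<odot>\<^bsub>V_y_model G \<eta> \<alpha> \<mu>\<^esub> f) u"
  proof (cases "u \<in> carrier G")
    case True
    then show ?thesis
      by (subst (1 2 3) V_y_model_smult_superset[where A = "Poly_Mapping.keys p \<union> Poly_Mapping.keys p'"])
         (use keys_add[of p p'] in \<open>auto simp: lookup_add ring_distribs sum.distrib split_def\<close>)
  qed (simp add: V_y_model_def)
qed

lemma V_y_model_smult_single:
  "Poly_Mapping.single (i, j, g) a \<odot>\<^bsub>V_y_model G \<eta> \<alpha> \<mu>\<^esub> f =
     (\<lambda>u. if u \<in> carrier G then a * 0 ^ i * (\<alpha> * inverse (\<eta> u)) ^ j * f (u \<otimes>\<^bsub>G\<^esub> g) else 0)"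
proof
  fix u show "(Poly_Mapping.single (i, j, g) a \<odot>\<^bsub>V_y_model G \<eta> \<alpha> \<mu>\<^esub> f) u = (if u \<in> carrier G then a * 0 ^ i * (\<alpha> * inverse (\<eta> u)) ^ j * f (u \<otimes>\<^bsub>G\<^esub> g) else 0)"
    by (cases "u \<in> carrier G", subst V_y_model_smult_superset[where A="{(i,j,g)}"]) (auto simp: V_y_model_def)
qed

lemma V_y_model_smult_sum:
  "(\<Sum>s\<in>S. F s) \<odot>\<^bsub>V_y_model G \<eta> \<alpha> \<mu>\<^esub> f = (\<lambda>u. \<Sum>s\<in>S. (F s \<odot>\<^bsub>V_y_model G \<eta> \<alpha> \<mu>\<^esub> f) u)"
proof (induction S rule: infinite_finite_induct)
  case (insert x S)
  then show ?case by (simp add: V_y_model_smult_add)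
qed (auto simp: V_y_model_def)

lemma V_y_model_smult_right:
  "p \<odot>\<^bsub>V_y_model G \<eta> \<alpha> \<mu>\<^esub> (\<lambda>u. \<Sum>s\<in>S. F s u) = (\<lambda>u. \<Sum>s\<in>S. (p \<odot>\<^bsub>V_y_model G \<eta> \<alpha> \<mu>\<^esub> F s) u)"
proof (induction S rule: infinite_finite_induct)
  case (insert x S)
  have "p \<odot>\<^bsub>V_y_model G \<eta> \<alpha> \<mu>\<^esub> (\<lambda>u. f u + f' u) =
    (\<lambda>u. (p \<odot>\<^bsub>V_y_model G \<eta> \<alpha> \<mu>\<^esub> f) u + (p \<odot>\<^bsub>V_y_model G \<eta> \<alpha> \<mu>\<^esub> f') u)" for f f'
    by (auto simp: V_y_model_def ring_distribs sum.distrib split_def)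
  with insert show ?case by simp
qed (auto simp: V_y_model_def)

lemma V_y_model_smult_assoc:
  fixes \<chi> \<eta> :: "'g \<Rightarrow> 'k::field"
  assumes "group G" "\<chi> \<in> hom G Kx" "\<eta> \<in> hom G Kx"
    "Poly_Mapping.keys p \<subseteq> UNIV \<times> UNIV \<times> carrier G" "Poly_Mapping.keys p' \<subseteq> UNIV \<times> UNIV \<times> carrier G"
  shows "skew_mult G \<chi> \<eta> p p' \<odot>\<^bsub>V_y_model G \<eta> \<alpha> \<mu>\<^esub> f = p \<odot>\<^bsub>V_y_model G \<eta> \<alpha> \<mu>\<^esub> (p' \<odot>\<^bsub>V_y_model G \<eta> \<alpha> \<mu>\<^esub> f)"
proof -
  interpret group G by fact
  have *: "skew_mult G \<chi> \<eta> (Poly_Mapping.single s a) (Poly_Mapping.single s' a') \<odot>\<^bsub>V_y_model G \<eta> \<alpha> \<mu>\<^esub> f =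
    Poly_Mapping.single s a \<odot>\<^bsub>V_y_model G \<eta> \<alpha> \<mu>\<^esub> (Poly_Mapping.single s' a' \<odot>\<^bsub>V_y_model G \<eta> \<alpha> \<mu>\<^esub> f)"
    if "s \<in> Poly_Mapping.keys p" "s' \<in> Poly_Mapping.keys p'" for s s' a a'
  proof -
    obtain i j g k l h where s: "s = (i, j, g)" "s' = (k, l, h)" by (cases s; cases s')
    have "g \<in> carrier G" "h \<in> carrier G" using that assms(4,5) s by auto
    then show ?thesis using assms(2,3) unfolding s
      by (cases "i = 0"; cases k; intro ext)
         (auto simp: skew_mult_single V_y_model_smult_single m_assoc char_mult power_add power_mult_distrib ac_simps)
  qed
  show ?thesis
    by (subst (1 2) skew_expand[of p], subst (1 2) skew_expand[of p'])
       (simp add: skew_mult_sum_left skew_mult_sum_right V_y_model_smult_sum V_y_model_smult_right *)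
qed

lemma left_module_V_y_model:
  fixes \<chi> \<eta> :: "'g \<Rightarrow> 'k::field"
  assumes G: "comm_group G" and ch: "\<chi> \<in> hom G Kx" "\<eta> \<in> hom G Kx"
  shows "left_module (skew_ring G \<chi> \<eta>) (V_y_model G \<eta> \<alpha> \<mu>)"
proof -
  interpret G: comm_group G by fact
  have *: "\<eta> (h \<otimes>\<^bsub>G\<^esub> u) = \<eta> u" "h \<otimes>\<^bsub>G\<^esub> u \<otimes>\<^bsub>G\<^esub> g = h \<otimes>\<^bsub>G\<^esub> (u \<otimes>\<^bsub>G\<^esub> g)" "h \<in> carrier G"
    if "h \<in> kernel G Kx \<eta>" "u \<in> carrier G" "g \<in> carrier G" for h u g
    using that ch by (auto simp: kernel_def char_mult G.m_assoc)
  interpret ring "skew_ring G \<chi> \<eta>" by (rule ring_skew_ring) (use assms in \<open>auto simp: G.is_group\<close>)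
  interpret M: abelian_group "V_y_model G \<eta> \<alpha> \<mu>"
  proof (rule abelian_groupI)
    show "\<exists>y\<in>carrier (V_y_model G \<eta> \<alpha> \<mu>). y \<oplus>\<^bsub>V_y_model G \<eta> \<alpha> \<mu>\<^esub> x = \<zero>\<^bsub>V_y_model G \<eta> \<alpha> \<mu>\<^esub>"
      if "x \<in> carrier (V_y_model G \<eta> \<alpha> \<mu>)" for x
      using that by (intro bexI[of _ "\<lambda>u. - x u"]) (auto simp: V_y_model_def)
  qed (auto simp: V_y_model_def ring_distribs ac_simps)
  show ?thesis
  proof (unfold_locales, goal_cases)
    case (1 p f)
    have "(p \<odot>\<^bsub>V_y_model G \<eta> \<alpha> \<mu>\<^esub> f) (h \<otimes>\<^bsub>G\<^esub> u) = \<mu> h * (p \<odot>\<^bsub>V_y_model G \<eta> \<alpha> \<mu>\<^esub> f) u"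
      if hu: "h \<in> kernel G Kx \<eta>" "u \<in> carrier G" for h u
    proof -
      have "h \<in> carrier G" using hu by (simp add: kernel_def)
      then show ?thesis
        using hu 1
        by (auto simp: V_y_model_def skew_ring_def sum_distrib_left *(1)[OF hu G.one_closed] *(2)[OF hu] ac_simps intro!: sum.cong)
    qed
    then show ?case by (simp add: V_y_model_def)
  next
    case (2 p p' f) then show ?case by (simp add: skew_ring_def V_y_model_smult_add) (simp add: V_y_model_def)
  next
    case (3 p f f') then show ?case
      by (auto simp: V_y_model_def ring_distribs sum.distrib split_def)
  next
    case (4 p p' f) then show ?case
      using V_y_model_smult_assoc[OF G.is_group ch] by (simp add: skew_ring_def)
  next
    case (5 f) then show ?case
      by (simp add: skew_ring_def V_y_model_smult_single) (auto simp: V_y_model_def)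
  qed
qed

lemma V_y_exists:
  fixes \<chi> \<eta> :: "'g \<Rightarrow> 'k::field"
  assumes G: "comm_group G" and b: "b \<in> carrier G" and ch: "\<chi> \<in> hom G Kx" "\<eta> \<in> hom G Kx"
    and n: "is_primitive_root n (\<eta> b)" and im: "\<eta> ` carrier G = generate Kx {\<eta> b}"
    and mu: "\<mu> \<in> hom (G\<lparr>carrier := kernel G Kx \<eta>\<rparr>) Kx"
  shows "is_V_y G \<chi> \<eta> b n \<alpha> \<mu> (V_y_model G \<eta> \<alpha> \<mu>)"
proof -
  interpret G: comm_group G by fact
  let ?M = "V_y_model G \<eta> \<alpha> \<mu>"
  let ?N = "kernel G Kx \<eta>"
  interpret left_module "skew_ring G \<chi> \<eta>" ?M by (rule left_module_V_y_model) fact+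
  have npos: "n > 0" and qn: "\<eta> b ^ n = 1" and qk: "\<And>k. 0 < k \<Longrightarrow> k < n \<Longrightarrow> \<eta> b ^ k \<noteq> 1"
    using n by (auto simp: is_primitive_root_def)
  have Nc: "h \<in> carrier G" "\<eta> h = 1" if "h \<in> ?N" for h using that by (auto simp: kernel_def)
  have NI: "h \<in> ?N" if "h \<in> carrier G" "\<eta> h = 1" for h using that by (auto simp: kernel_def)
  have eb: "\<eta> (b [^]\<^bsub>G\<^esub> i) = \<eta> b ^ i" for i :: nat
    by (induction i) (use b ch in \<open>simp_all add: char_mult char_one[OF _ G.is_group]\<close>)
  have mum: "\<mu> (h \<otimes>\<^bsub>G\<^esub> h') = \<mu> h * \<mu> h'" if "h \<in> ?N" "h' \<in> ?N" for h h'
    using mu that by (simp add: hom_def)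
  have mu0: "\<mu> h \<noteq> 0" if "h \<in> ?N" for h using mu that by (auto simp: hom_def Pi_def)
  have N1: "\<one>\<^bsub>G\<^esub> \<in> ?N" using ch by (intro NI) (auto simp: char_one[OF _ G.is_group])
  have mu1: "\<mu> \<one>\<^bsub>G\<^esub> = 1" using mum[OF N1 N1] mu0[OF N1] by simp
  have e0: "\<eta> u \<noteq> 0" if "u \<in> carrier G" for u using char_nonzero[OF ch(2) that] .
  define v where "v = (\<lambda>(i::nat) u. if u \<in> carrier G \<and> u \<otimes>\<^bsub>G\<^esub> b [^]\<^bsub>G\<^esub> i \<in> ?N then \<mu> (u \<otimes>\<^bsub>G\<^esub> b [^]\<^bsub>G\<^esub> i) else 0)"
  have Nm: "h \<otimes>\<^bsub>G\<^esub> u \<in> ?N \<longleftrightarrow> u \<in> ?N" if "h \<in> ?N" "u \<in> carrier G" for h u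
    using that ch by (auto simp: kernel_def char_mult)
  have vc: "v i \<in> carrier ?M" for i
  proof -
    have "v i (h \<otimes>\<^bsub>G\<^esub> u) = \<mu> h * v i u" if "h \<in> ?N" "u \<in> carrier G" for h u
      using that b Nc[OF that(1)] Nm[of h "u \<otimes>\<^bsub>G\<^esub> b [^]\<^bsub>G\<^esub> i"] by (auto simp: v_def G.m_assoc mum)
    then show ?thesis by (auto simp: V_y_model_def v_def)
  qed
  have sc: "elt_scalar G a \<odot>\<^bsub>?M\<^esub> f = (\<lambda>u. a * f u)" if "f \<in> carrier ?M" for a f
    using that unfolding elt_scalar_def V_y_model_smult_single by (auto simp: V_y_model_def)
  have scl: "(\<lambda>u. a * f u) \<in> carrier ?M" if "f \<in> carrier ?M" for a f
    using that by (auto simp: V_y_model_def)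
  have fs: "(\<Oplus>\<^bsub>?M\<^esub>i\<in>S. F i) = (\<lambda>u. \<Sum>i\<in>S. F i u)" if "finite S" "\<And>i. i \<in> S \<Longrightarrow> F i \<in> carrier ?M" for S and F :: "nat \<Rightarrow> 'g \<Rightarrow> 'k"
    using that
  proof (induction S)
    case empty show ?case by (simp add: finsum_empty) (simp add: V_y_model_def)
  next
    case (insert x S)
    then have "(\<Oplus>\<^bsub>?M\<^esub>i\<in>insert x S. F i) = F x \<oplus>\<^bsub>?M\<^esub> (\<Oplus>\<^bsub>?M\<^esub>i\<in>S. F i)" by (intro M.finsum_insert) auto
    with insert show ?case by (simp add: V_y_model_def)
  qed
  have cong: "i = k" if "\<eta> b ^ i = \<eta> b ^ k" "i < n" "k < n" for i k
  proof -
    have "i = k" if "\<eta> b ^ i = \<eta> b ^ k" "i \<le> k" "k < n" for i k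
    proof (rule ccontr)
      assume "i \<noteq> k"
      have "\<eta> b ^ k = \<eta> b ^ i * \<eta> b ^ (k - i)" using power_add[of "\<eta> b" i "k - i"] that(2) by simp
      then have "\<eta> b ^ (k - i) = 1" using that e0[OF b] by simp
      moreover have "0 < k - i" "k - i < n" using \<open>i \<noteq> k\<close> that by linarith+
      ultimately show False using qk by blast
    qed
    then show ?thesis using that by (metis nat_le_linear)
  qed
  have im': "\<exists>i<n. \<eta> u = \<eta> b ^ i" if "u \<in> carrier G" for u
  proof -
    have "\<eta> u \<in> generate Kx {\<eta> b}" using im that by blast
    then have "\<exists>i. \<eta> u = \<eta> b ^ i"
    proof induction
      case one show ?case by (auto intro: exI[of _ 0])
    next
      case (incl h) then show ?case by (auto intro: exI[of _ 1])
    next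
      case (inv h)
      have "inv\<^bsub>Kx\<^esub> (\<eta> b) = \<eta> b ^ (n - 1)"
        using e0[OF b] qn npos group_Kx[where ?'k='k]
        by (intro group.inv_equality) (auto simp: comm_group_def simp flip: power_Suc2)
      with inv show ?case by auto
    next
      case (eng h h') then show ?case by (auto simp flip: power_add)
    qed
    then obtain i where "\<eta> u = \<eta> b ^ i" ..
    moreover have "\<eta> b ^ i = \<eta> b ^ (i mod n)"
      using power_add[of "\<eta> b" "n * (i div n)" "i mod n"] by (simp add: power_mult qn)
    ultimately show ?thesis using npos by (intro exI[of _ "i mod n"]) auto
  qed
  define w where "w i = inv\<^bsub>G\<^esub> (b [^]\<^bsub>G\<^esub> i)" for i :: nat
  have wc: "w i \<in> carrier G" for i using b by (simp add: w_def)
  have ew: "\<eta> (w i) * \<eta> b ^ i = 1" for i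
    using char_mult[OF ch(2) wc[of i], of "b [^]\<^bsub>G\<^esub> i"] b ch by (simp add: w_def eb char_one[OF _ G.is_group])
  have vw: "v k (w i) = (if k = i then 1 else 0)" if "k < n" "i < n" for k i
  proof (cases "k = i")
    case True then show ?thesis using b N1 mu1 by (simp add: v_def w_def)
  next
    case False
    have "w i \<otimes>\<^bsub>G\<^esub> b [^]\<^bsub>G\<^esub> k \<notin> ?N"
    proof
      assume "w i \<otimes>\<^bsub>G\<^esub> b [^]\<^bsub>G\<^esub> k \<in> ?N"
      then have "\<eta> (w i) * \<eta> b ^ k = 1" using Nc(2) char_mult[OF ch(2) wc] b eb by fastforce
      then have "\<eta> b ^ k = \<eta> b ^ i" using ew[of i] by (metis mult.left_commute mult.right_neutral)
      then show False using cong that False by blast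
    qed
    then show ?thesis using False by (simp add: v_def)
  qed
  have dec: "\<exists>i<n. \<exists>h\<in>?N. u = h \<otimes>\<^bsub>G\<^esub> w i" if u: "u \<in> carrier G" for u
  proof -
    obtain i where i: "i < n" "\<eta> u * \<eta> b ^ i = 1"
      using im'[of "inv\<^bsub>G\<^esub> u"] u char_mult[OF ch(2) u, of "inv\<^bsub>G\<^esub> u"] char_one[OF ch(2) G.is_group]
      by auto
    have "u \<otimes>\<^bsub>G\<^esub> b [^]\<^bsub>G\<^esub> i \<in> ?N" using u b i(2) by (intro NI) (auto simp: char_mult[OF ch(2)] eb)
    moreover have "u = u \<otimes>\<^bsub>G\<^esub> b [^]\<^bsub>G\<^esub> i \<otimes>\<^bsub>G\<^esub> w i" using u b by (simp add: w_def G.m_assoc)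
    ultimately show ?thesis using i(1) by blast
  qed
  have ext: "f = f'" if "f \<in> carrier ?M" "f' \<in> carrier ?M" "\<And>i. i < n \<Longrightarrow> f (w i) = f' (w i)" for f f'
  proof
    fix u show "f u = f' u"
    proof (cases "u \<in> carrier G")
      case True
      then obtain i h where "i < n" "h \<in> ?N" "u = h \<otimes>\<^bsub>G\<^esub> w i" using dec by blast
      then show ?thesis using that wc[of i] by (simp add: V_y_model_def)
    next
      case False then show ?thesis using that by (simp add: V_y_model_def)
    qed
  qed
  have basis: "K_basis G ?M n v"
    unfolding K_basis_def
  proof (intro conjI ballI)
    show "v \<in> {..<n} \<rightarrow> carrier ?M" using vc by simp
    fix f assume f: "f \<in> carrier ?M"
    have lc: "(\<Oplus>\<^bsub>?M\<^esub>i\<in>{..<n}. elt_scalar G (a i) \<odot>\<^bsub>?M\<^esub> v i) = (\<lambda>u. \<Sum>i<n. a i * v i u)" for a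
      by (subst fs) (auto simp: sc vc scl)
    have lcc: "(\<lambda>u. \<Sum>i<n. a i * v i u) \<in> carrier ?M" for a
      unfolding lc[symmetric] by (intro M.finsum_closed) (auto simp: sc vc scl)
    have at: "(\<Sum>k<n. a k * v k (w i)) = a i" if "i < n" for a i
    proof -
      have "(\<Sum>k<n. a k * v k (w i)) = (\<Sum>k<n. if k = i then a k else 0)"
        by (rule sum.cong) (use vw that in auto)
      then show ?thesis using that by simp
    qed
    show "\<exists>!a. a \<in> {..<n} \<rightarrow>\<^sub>E UNIV \<and> f = (\<Oplus>\<^bsub>?M\<^esub>i\<in>{..<n}. elt_scalar G (a i) \<odot>\<^bsub>?M\<^esub> v i)"
      unfolding lc
    proof (rule ex1I[of _ "restrict (\<lambda>i. f (w i)) {..<n}"])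
      show "restrict (\<lambda>i. f (w i)) {..<n} \<in> {..<n} \<rightarrow>\<^sub>E UNIV \<and> f = (\<lambda>u. \<Sum>i<n. restrict (\<lambda>i. f (w i)) {..<n} i * v i u)"
        by (intro conjI ext f lcc) (auto simp: at)
      fix a assume a: "a \<in> {..<n} \<rightarrow>\<^sub>E UNIV \<and> f = (\<lambda>u. \<Sum>i<n. a i * v i u)"
      then have "f (w i) = a i" if "i < n" for i using at[OF that, of a] by simp
      then show "a = restrict (\<lambda>i. f (w i)) {..<n}" using a by (auto simp: PiE_def extensional_def fun_eq_iff)
    qed
  qed
  have x: "elt_x G \<odot>\<^bsub>?M\<^esub> v i = \<zero>\<^bsub>?M\<^esub>" for i
    unfolding elt_x_def V_y_model_smult_single by (auto simp: V_y_model_def)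
  have y: "elt_y G \<odot>\<^bsub>?M\<^esub> v i = elt_scalar G (\<eta> b ^ i * \<alpha>) \<odot>\<^bsub>?M\<^esub> v i" for i
  proof -
    have "\<alpha> * inverse (\<eta> u) * v i u = \<eta> b ^ i * \<alpha> * v i u" if u: "u \<in> carrier G" for u
    proof (cases "u \<otimes>\<^bsub>G\<^esub> b [^]\<^bsub>G\<^esub> i \<in> ?N")
      case True
      then have "\<eta> u * \<eta> b ^ i = 1" using Nc(2) char_mult[OF ch(2) u] b eb by fastforce
      then show ?thesis by (simp add: inverse_unique)
    qed (simp add: v_def)
    then show ?thesis unfolding sc[OF vc] elt_y_def V_y_model_smult_single by (auto simp: v_def)
  qed
  have h: "elt_grp h \<odot>\<^bsub>?M\<^esub> v i = elt_scalar G (\<mu> h) \<odot>\<^bsub>?M\<^esub> v i" if "h \<in> ?N" for h i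
  proof -
    have "v i (u \<otimes>\<^bsub>G\<^esub> h) = \<mu> h * v i u" if "u \<in> carrier G" for u
      using vc[of i] \<open>h \<in> ?N\<close> that Nc by (simp add: V_y_model_def G.m_comm)
    then show ?thesis unfolding sc[OF vc] elt_grp_def V_y_model_smult_single by (auto simp: v_def)
  qed
  have bS: "elt_grp b \<odot>\<^bsub>?M\<^esub> v i = v (i + 1)" for i
    unfolding elt_grp_def V_y_model_smult_single
  proof -
    have "u \<otimes>\<^bsub>G\<^esub> b \<otimes>\<^bsub>G\<^esub> b [^]\<^bsub>G\<^esub> i = u \<otimes>\<^bsub>G\<^esub> b [^]\<^bsub>G\<^esub> (i + 1)" if "u \<in> carrier G" for u
      using b that by (simp add: G.m_assoc G.m_comm[of b])
    then show "(\<lambda>u. if u \<in> carrier G then 1 * 0 ^ 0 * (\<alpha> * inverse (\<eta> u)) ^ 0 * v i (u \<otimes>\<^bsub>G\<^esub> b) else 0) = v (i + 1)"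
      using b by (auto simp: v_def fun_eq_iff)
  qed
  have bn: "b [^]\<^bsub>G\<^esub> n \<in> ?N" using b eb qn by (intro NI) auto
  have vn: "v n = elt_scalar G (\<mu> (b [^]\<^bsub>G\<^esub> n)) \<odot>\<^bsub>?M\<^esub> v 0"
  proof -
    have "u \<otimes>\<^bsub>G\<^esub> b [^]\<^bsub>G\<^esub> n \<in> ?N \<longleftrightarrow> u \<in> ?N" if "u \<in> carrier G" for u
      using Nm[OF bn that] bn Nc that by (simp add: G.m_comm)
    then show ?thesis unfolding sc[OF vc] by (auto simp: v_def mum bn fun_eq_iff)
  qed
  have bi: "elt_grp b \<odot>\<^bsub>?M\<^esub> v i = (if i = n - 1 then elt_scalar G (\<mu> (b [^]\<^bsub>G\<^esub> n)) \<odot>\<^bsub>?M\<^esub> v 0 else v (i + 1))" for i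
    using npos vn by (cases "i = n - 1") (auto simp: bS)
  show ?thesis
    unfolding is_V_y_def
    by (intro conjI exI[of _ v] allI impI ballI left_module_axioms basis x y h bi left_module_V_y_model G ch)
qed

end

theory Submission
  imports Defs
begin

text \<open>
  Let \<open>V\<close> be simple, \<open>x\<close>-torsion and \<open>y\<close>-torsion-free. The kernel of \<open>x\<close> is a nonzero submodule,
  so \<open>x\<close> acts by zero. What remains is a simple module over \<open>K[y]#G\<close>, in which \<open>y\<^sup>n\<close> and the
  elements of \<open>N = ker \<eta>\<close> are central. Once these are known to act by scalars, an eigenvector
  \<open>w\<close> of \<open>y\<close> exists, with an eigenvalue \<open>\<alpha>\<close> that is nonzero as there is no \<open>y\<close>-torsion, and
  the vectors \<open>w, b w, \<dots>, b\<^bsup>n-1\<^esup> w\<close> are eigenvectors of \<open>y\<close> for the distinct eigenvalues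
  \<open>q\<^sup>i \<alpha>\<close>. They span a submodule because \<open>G\<close> is generated by \<open>N\<close> and \<open>b\<close> and \<open>b\<^sup>n \<in> N\<close>, so
  they form the required basis (\<open>is_V_y_from_eigenvector\<close>).

  The substantial step is that central elements act by scalars
  (\<open>central_monomial_acts_by_scalar\<close>). Since the dimension of \<open>V\<close> is not known to be finite and
  \<open>K\<close> may be countable, this is a version of the Nullstellensatz. By Schur's lemma it is enough to
  show that for a central operator \<open>T\<close> some translate \<open>T - k\<close> is not bijective. The module is
  spanned by vectors \<open>e a\<close> indexed by exponent vectors \<open>a\<close>, namely a fixed vector multiplied by
  monomials in \<open>y\<close> and in generators of \<open>G\<close>. If all translates were bijective, the module
  would be torsion-free and divisible over \<open>K[T]\<close>. But an argument in the style of Groebner bases,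
  with Dickson's lemma providing finiteness, shows that over \<open>K[T]\<close> it becomes free after
  inverting a single polynomial, and a nonzero module of this kind is not divisible
  (\<open>some_translate_not_bijective\<close>).

  For the isomorphism criterion, the basis shows that the eigenvalues of \<open>y\<close> on
  \<open>V\<^sub>y(\<alpha>,\<lambda>)\<close> are the \<open>q\<^sup>i \<alpha>\<close> and that \<open>h \<in> N\<close> acts by \<open>\<lambda>(h)\<close>, which isomorphisms
  preserve. Conversely, a module with parameter \<open>\<alpha>\<close> also has every parameter
  \<open>q\<^sup>i \<alpha>\<close>, by starting its basis at another vector (\<open>is_V_y_shift\<close>), and equal parameters give equal actions
  on the bases.
\<close>

section \<open>Vector spaces and polynomials in an operator\<close>

text \<open>The field is a type, while the vectors form the carrier of a record. This is the shape in
  which \<open>K\<close> acts on a module over the skew group ring.\<close>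

locale K_space = abelian_group V for V :: "('v, 'd) ring_scheme" (structure) +
  fixes scale :: "'k::field \<Rightarrow> 'v \<Rightarrow> 'v"
  assumes scale_closed [simp]: "u \<in> carrier V \<Longrightarrow> scale a u \<in> carrier V"
    and scale_add_left: "u \<in> carrier V \<Longrightarrow> scale (a + a') u = scale a u \<oplus> scale a' u"
    and scale_add_right: "u \<in> carrier V \<Longrightarrow> w \<in> carrier V \<Longrightarrow> scale a (u \<oplus> w) = scale a u \<oplus> scale a w"
    and scale_scale: "u \<in> carrier V \<Longrightarrow> scale a (scale a' u) = scale (a * a') u"
    and scale_one [simp]: "u \<in> carrier V \<Longrightarrow> scale 1 u = u"

definition linear_map ::
  "('v, 'd) ring_scheme \<Rightarrow> ('k \<Rightarrow> 'v \<Rightarrow> 'v) \<Rightarrow> ('w, 'e) ring_scheme \<Rightarrow> ('k \<Rightarrow> 'w \<Rightarrow> 'w) \<Rightarrow> ('v \<Rightarrow> 'w) \<Rightarrow> bool"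
  where
  "linear_map V s W t f \<longleftrightarrow> f \<in> carrier V \<rightarrow> carrier W \<and>
     (\<forall>u\<in>carrier V. \<forall>u'\<in>carrier V. f (u \<oplus>\<^bsub>V\<^esub> u') = f u \<oplus>\<^bsub>W\<^esub> f u') \<and>
     (\<forall>a. \<forall>u\<in>carrier V. f (s a u) = t a (f u))"

lemma linear_map_closed: "linear_map V s W t f \<Longrightarrow> u \<in> carrier V \<Longrightarrow> f u \<in> carrier W"
  and linear_map_add: "linear_map V s W t f \<Longrightarrow> u \<in> carrier V \<Longrightarrow> u' \<in> carrier V \<Longrightarrow> f (u \<oplus>\<^bsub>V\<^esub> u') = f u \<oplus>\<^bsub>W\<^esub> f u'"
  and linear_map_scale: "linear_map V s W t f \<Longrightarrow> u \<in> carrier V \<Longrightarrow> f (s a u) = t a (f u)"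
  by (auto simp: linear_map_def)

context K_space
begin

lemma scale_zero_left [simp]: "u \<in> carrier V \<Longrightarrow> scale 0 u = \<zero>"
  using scale_add_left[of u 0 0] by (simp add: add.r_cancel_one')

lemma scale_zero_right [simp]: "scale a \<zero> = \<zero>"
  using scale_add_right[of \<zero> \<zero> a] by (simp add: add.r_cancel_one')

lemma scale_eq_zero: "u \<in> carrier V \<Longrightarrow> scale a u = \<zero> \<Longrightarrow> a = 0 \<or> u = \<zero>"
  using scale_scale[of u "inverse a" a] by (cases "a = 0") auto

lemma scale_minus: "u \<in> carrier V \<Longrightarrow> scale (- a) u = \<ominus> scale a u"
  using scale_add_left[of u "- a" a] by (simp add: minus_equality)

lemma scale_cancel:
  assumes "u \<in> carrier V" "u \<noteq> \<zero>" "scale a u = scale a' u"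
  shows "a = a'"
proof -
  have "scale (a + - a') u = \<zero>" using assms by (simp only: scale_add_left scale_minus scale_closed r_neg)
  then show ?thesis using scale_eq_zero[of u "a + - a'"] assms by simp
qed

lemma minus_eq_zero_iff: "u \<in> carrier V \<Longrightarrow> w \<in> carrier V \<Longrightarrow> u \<ominus> w = \<zero> \<longleftrightarrow> u = w"
  by (metis a_minus_def a_inv_closed minus_equality minus_minus r_neg)

lemma linear_map_zero:
  assumes "linear_map V scale W t f" "abelian_group W"
  shows "f \<zero> = \<zero>\<^bsub>W\<^esub>"
proof -
  interpret W: abelian_group W by fact
  show ?thesis
    using linear_map_add[OF assms(1), of \<zero> \<zero>] linear_map_closed[OF assms(1), of \<zero>]
    by (simp add: W.add.r_cancel_one')
qed

text \<open>Horner's scheme for \<open>p(T) u\<close>. Through it the space is a module over \<open>K[T]\<close>.\<close>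

definition poly_act :: "('v \<Rightarrow> 'v) \<Rightarrow> 'k poly \<Rightarrow> 'v \<Rightarrow> 'v" where
  "poly_act T p u = fold_coeffs (\<lambda>a w. scale a u \<oplus> T w) p \<zero>"

end

locale K_operator = K_space V scale
  for V :: "('v, 'd) ring_scheme" (structure) and scale :: "'k::field \<Rightarrow> 'v \<Rightarrow> 'v" +
  fixes T :: "'v \<Rightarrow> 'v"
  assumes T_linear: "linear_map V scale V scale T"
begin

abbreviation act (infixr \<open>\<star>\<close> 75) where "p \<star> u \<equiv> poly_act T p u"

lemma T_closed [simp]: "u \<in> carrier V \<Longrightarrow> T u \<in> carrier V"
  and T_add: "u \<in> carrier V \<Longrightarrow> w \<in> carrier V \<Longrightarrow> T (u \<oplus> w) = T u \<oplus> T w"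
  and T_scale: "u \<in> carrier V \<Longrightarrow> T (scale a u) = scale a (T u)"
  using linear_map_closed[OF T_linear] linear_map_add[OF T_linear] linear_map_scale[OF T_linear]
  by auto

lemma T_zero [simp]: "T \<zero> = \<zero>"
  using linear_map_zero[OF T_linear] by (simp add: abelian_group_axioms)

lemma act_0 [simp]: "0 \<star> u = \<zero>"
  by (simp add: poly_act_def)

lemma act_pCons: "u \<in> carrier V \<Longrightarrow> pCons a p \<star> u = scale a u \<oplus> T (p \<star> u)"
  by (cases "a = 0 \<and> p = 0") (auto simp: poly_act_def)

lemma act_closed [simp]: "u \<in> carrier V \<Longrightarrow> p \<star> u \<in> carrier V"
  by (induction p) (auto simp: act_pCons)

lemma act_const [simp]: "u \<in> carrier V \<Longrightarrow> [:a:] \<star> u = scale a u"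
  by (simp add: act_pCons)

lemma act_1 [simp]: "u \<in> carrier V \<Longrightarrow> 1 \<star> u = u"
  by (simp add: one_pCons)

lemma act_add_left: "u \<in> carrier V \<Longrightarrow> (p + p') \<star> u = p \<star> u \<oplus> p' \<star> u"
  by (induction p p' rule: poly_induct2) (auto simp: act_pCons scale_add_left T_add a_ac)

lemma act_smult: "u \<in> carrier V \<Longrightarrow> smult a p \<star> u = scale a (p \<star> u)"
  by (induction p) (auto simp: act_pCons scale_add_right T_scale scale_scale mult.commute)

lemma act_mult: "u \<in> carrier V \<Longrightarrow> (p * p') \<star> u = p \<star> p' \<star> u"
  by (induction p) (auto simp: act_pCons act_add_left act_smult)

lemma act_commute: "u \<in> carrier V \<Longrightarrow> p \<star> p' \<star> u = p' \<star> p \<star> u"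
  by (metis act_mult mult.commute)

lemma act_linear_map:
  assumes f: "linear_map V scale V scale f" and comm: "\<And>u. u \<in> carrier V \<Longrightarrow> f (T u) = T (f u)"
    and u: "u \<in> carrier V"
  shows "f (p \<star> u) = p \<star> f u"
proof -
  note [simp] = linear_map_closed[OF f] linear_map_add[OF f] linear_map_scale[OF f]
  show ?thesis
    using linear_map_zero[OF f abelian_group_axioms] u
    by (induction p) (auto simp: act_pCons comm)
qed

lemma act_add_right: "u \<in> carrier V \<Longrightarrow> w \<in> carrier V \<Longrightarrow> p \<star> (u \<oplus> w) = p \<star> u \<oplus> p \<star> w"
  by (induction p) (auto simp: act_pCons scale_add_right T_add a_ac)

lemma act_zero_right [simp]: "p \<star> \<zero> = \<zero>"
  by (induction p) (auto simp: act_pCons)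

lemma act_scale: "u \<in> carrier V \<Longrightarrow> p \<star> scale a u = scale a (p \<star> u)"
  using act_commute[of u p "[:a:]"] by simp

lemma act_eigenvector: "u \<in> carrier V \<Longrightarrow> T u = scale a u \<Longrightarrow> p \<star> u = scale (poly p a) u"
  by (induction p) (auto simp: act_pCons T_scale scale_add_left scale_scale mult.commute)

lemma act_linear_factor: "u \<in> carrier V \<Longrightarrow> [:- a, 1:] \<star> u = T u \<ominus> scale a u"
  by (simp add: act_pCons scale_minus a_minus_def a_comm)

lemma act_linear_factor_eq_0: "u \<in> carrier V \<Longrightarrow> [:- a, 1:] \<star> u = \<zero> \<longleftrightarrow> T u = scale a u"
  by (simp add: act_linear_factor minus_eq_zero_iff)

end

locale K_operator_closed = K_operator V scale T
  for V :: "('v, 'd) ring_scheme" (structure)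
    and scale :: "'k::{alg_closed_field, field_char_0} \<Rightarrow> 'v \<Rightarrow> 'v" and T :: "'v \<Rightarrow> 'v"
begin

text \<open>A polynomial is a product of linear factors, and a linear factor can only kill an
  eigenvector. This is where the field has to be algebraically closed.\<close>

lemma torsion_free_if_no_eigenvector:
  assumes noeig: "\<And>a u. u \<in> carrier V \<Longrightarrow> T u = scale a u \<Longrightarrow> u = \<zero>"
    and p: "p \<noteq> 0" and u: "u \<in> carrier V" and pu: "p \<star> u = \<zero>"
  shows "u = \<zero>"
  using p pu
proof (induction "degree p" arbitrary: p)
  case 0
  then obtain a where "p = [:a:]" by (metis degree_eq_zeroE)
  with 0 show ?case using u scale_eq_zero by auto
next
  case (Suc d)
  then obtain a where "poly p a = 0" using alg_closed_imp_poly_has_root[of p] by auto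
  then obtain p' where p': "p = [:- a, 1:] * p'" by (auto simp: poly_eq_0_iff_dvd)
  with Suc have "p' \<noteq> 0" by auto
  then have "degree p' = d" using Suc p' by (simp add: degree_mult_eq del: mult_pCons_left)
  moreover have "p' \<star> u = \<zero>"
    using Suc.prems(2) u noeig[of "p' \<star> u" a]
    by (simp add: p' act_mult act_linear_factor_eq_0 del: mult_pCons_left)
  ultimately show ?case using Suc \<open>p' \<noteq> 0\<close> by blast
qed

end

section \<open>Exponent vectors\<close>

text \<open>Dickson's lemma, with the componentwise order on exponent vectors. In the induction, the
  heads can be bounded: the tails of all vectors in \<open>U\<close> are above finitely many tails
  \<open>f\<close>, which occur with heads \<open>J f\<close>. A vector whose head is at least the largest \<open>J f\<close> is
  above some \<open>J f # f\<close>, and the finitely many smaller heads are treated one at a time.\<close>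

lemma dickson:
  assumes "U \<subseteq> {a :: nat list. length a = r}"
  shows "\<exists>F. finite F \<and> F \<subseteq> U \<and> (\<forall>u\<in>U. \<exists>f\<in>F. list_all2 (\<le>) f u)"
  using assms
proof (induction r arbitrary: U)
  case 0
  then have "U \<subseteq> {[]}" by auto
  then show ?case by (intro exI[of _ U]) (auto intro: finite_subset)
next
  case (Suc r)
  let ?slice = "\<lambda>j. {a. j # a \<in> U}"
  have slice: "?slice j \<subseteq> {a. length a = r}" for j using Suc.prems by auto
  obtain F where F: "finite F" "F \<subseteq> (\<Union>j. ?slice j)" "\<And>u. u \<in> (\<Union>j. ?slice j) \<Longrightarrow> \<exists>f\<in>F. list_all2 (\<le>) f u"
    using Suc.IH[of "\<Union>j. ?slice j"] slice by (metis (no_types, lifting) UN_least)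
  have "\<forall>f\<in>F. \<exists>j. j # f \<in> U" using F(2) by auto
  then obtain J where J: "\<And>f. f \<in> F \<Longrightarrow> J f # f \<in> U" by metis
  obtain F' where F': "\<And>j. finite (F' j)" "\<And>j. F' j \<subseteq> ?slice j" "\<And>j u. u \<in> ?slice j \<Longrightarrow> \<exists>f\<in>F' j. list_all2 (\<le>) f u"
    using Suc.IH[OF slice] by metis
  show ?case
  proof (intro exI[of _ "(\<lambda>f. J f # f) ` F \<union> (\<Union>j\<in>{..<Max (insert 0 (J ` F))}. (#) j ` F' j)"] conjI ballI)
    fix u assume u: "u \<in> U"
    then obtain j a where ja: "u = j # a" "length a = r" using Suc.prems by (auto simp: length_Suc_conv)
    show "\<exists>f\<in>(\<lambda>f. J f # f) ` F \<union> (\<Union>j\<in>{..<Max (insert 0 (J ` F))}. (#) j ` F' j). list_all2 (\<le>) f u"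
    proof (cases "j < Max (insert 0 (J ` F))")
      case True
      then show ?thesis using F'(3)[of a j] u ja by auto
    next
      case False
      obtain f where f: "f \<in> F" "list_all2 (\<le>) f a" using F(3)[of a] u ja by blast
      then have "J f \<le> j" using False F(1) by (meson Max_ge finite_imageI finite_insert image_eqI insertI2 le_trans not_le)
      then show ?thesis using f ja by auto
    qed
  qed (use F F'(1) J subsetD[OF F'(2)] in auto)
qed

lemma list_all2_le_imp_sum:
  "list_all2 (\<le>) f (u :: nat list) \<Longrightarrow> u = map2 (+) (map2 (-) u f) f \<and> length (map2 (-) u f) = length u"
  by (induction rule: list_all2_induct) auto

lemma lex_map2_add:
  "length c = length a \<Longrightarrow> length b = length a \<Longrightarrow>
   (map2 (+) c a, map2 (+) c b) \<in> lex less_than \<longleftrightarrow> (a, b) \<in> lex less_than"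
  by (induction c a arbitrary: b rule: list_induct2; case_tac b) auto

lemma lex_total:
  "length a = length b \<Longrightarrow> a = b \<or> (a, b) \<in> lex less_than \<or> (b, a) \<in> lex (less_than)"
  by (induction a b rule: list_induct2) auto

section \<open>Operators whose translates are all bijective\<close>

context K_operator
begin

inductive_set poly_span :: "'v set \<Rightarrow> 'v set" for E where
  zero: "\<zero> \<in> poly_span E"
| step: "w \<in> poly_span E \<Longrightarrow> x \<in> E \<Longrightarrow> p \<star> x \<oplus> w \<in> poly_span E"

lemma poly_span_closed:
  assumes "E \<subseteq> carrier V"
  shows "w \<in> poly_span E \<Longrightarrow> w \<in> carrier V"
  by (induction rule: poly_span.induct) (use assms in auto)

lemma poly_span_add:
  assumes "E \<subseteq> carrier V" "w' \<in> poly_span E"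
  shows "w \<in> poly_span E \<Longrightarrow> w \<oplus> w' \<in> poly_span E"
  by (induction rule: poly_span.induct)
    (use assms poly_span_closed in \<open>auto simp: a_assoc subset_iff poly_span.step\<close>)

lemma poly_span_image:
  assumes f: "linear_map V scale V scale f" and comm: "\<And>u. u \<in> carrier V \<Longrightarrow> f (T u) = T (f u)"
    and E: "E \<subseteq> carrier V" "E' \<subseteq> carrier V" and fE: "\<And>p x. x \<in> E \<Longrightarrow> p \<star> f x \<in> poly_span E'"
  shows "w \<in> poly_span E \<Longrightarrow> f w \<in> poly_span E'"
proof (induction rule: poly_span.induct)
  case zero
  then show ?case using linear_map_zero[OF f abelian_group_axioms] by (simp add: poly_span.zero)
next
  case (step w x p)
  then have "f (p \<star> x \<oplus> w) = p \<star> f x \<oplus> f w"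
    using E poly_span_closed by (simp add: linear_map_add[OF f] act_linear_map[OF f comm] subset_iff)
  with step fE E show ?case by (simp add: poly_span_add)
qed

lemma poly_span_base: "E \<subseteq> carrier V \<Longrightarrow> x \<in> E \<Longrightarrow> p \<star> x \<in> poly_span E"
  using poly_span.step[OF poly_span.zero, of x E p] by (auto simp: subset_iff)

lemma linear_map_act: "linear_map V scale V scale ((\<star>) p)"
  by (simp add: linear_map_def act_add_right act_scale)

lemma act_T: "u \<in> carrier V \<Longrightarrow> p \<star> T u = T (p \<star> u)"
  using act_linear_map[OF T_linear] by simp

lemma poly_span_act: "E \<subseteq> carrier V \<Longrightarrow> w \<in> poly_span E \<Longrightarrow> p \<star> w \<in> poly_span E"
  by (rule poly_span_image[OF linear_map_act act_T])
    (auto simp: subset_iff intro!: poly_span_base simp flip: act_mult)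

lemma poly_span_minus: "E \<subseteq> carrier V \<Longrightarrow> w \<in> poly_span E \<Longrightarrow> \<ominus> w \<in> poly_span E"
  using poly_span_act[of E w "[:- 1:]"] poly_span_closed[of E w] by (simp add: scale_minus)

lemma poly_span_mono: "E \<subseteq> E' \<Longrightarrow> w \<in> poly_span E \<Longrightarrow> w \<in> poly_span E'"
  by (rotate_tac, induction rule: poly_span.induct) (auto intro: poly_span.intros)

text \<open>A combination involves only finitely many indices, hence has a largest one.\<close>

lemma poly_span_initial_segment:
  assumes A: "A \<subseteq> {a. length a = r}" and e: "\<And>a. length a = r \<Longrightarrow> e a \<in> carrier V"
  shows "w \<in> poly_span (e ` A) \<Longrightarrow>
    w = \<zero> \<or> (\<exists>\<nu>\<in>A. w \<in> poly_span (e ` {a. length a = r \<and> (a = \<nu> \<or> (a, \<nu>) \<in> lex less_than)}))"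
proof (induction rule: poly_span.induct)
  case (step w x p)
  let ?I = "\<lambda>\<nu>. {a. length a = r \<and> (a = \<nu> \<or> (a, \<nu>) \<in> lex less_than)}"
  have c: "e ` ?I \<nu> \<subseteq> carrier V" for \<nu> using e by auto
  obtain a where a: "x = e a" "a \<in> A" "length a = r" using step A by auto
  have x: "p \<star> x \<in> poly_span (e ` ?I \<nu>)" if "a = \<nu> \<or> (a, \<nu>) \<in> lex less_than" for \<nu>
    using that a by (intro poly_span_base c) auto
  from step.IH show ?case
  proof (elim disjE bexE)
    assume "w = \<zero>"
    with x[of a] show ?thesis using a c e by auto
  next
    fix \<nu> assume \<nu>: "\<nu> \<in> A" "w \<in> poly_span (e ` ?I \<nu>)"
    have "length a = length \<nu>" using \<nu>(1) A a by auto
    from lex_total[OF this] consider "a = \<nu> \<or> (a, \<nu>) \<in> lex less_than" | "(\<nu>, a) \<in> lex less_than" by blast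
    then show ?thesis
    proof cases
      case 1
      then show ?thesis using x \<nu> poly_span_add[OF c] by blast
    next
      case 2
      have "?I \<nu> \<subseteq> ?I a" using 2 lex_transI[OF trans_less_than] by (auto dest: transD)
      then have "w \<in> poly_span (e ` ?I a)" using \<nu>(2) by (meson image_mono poly_span_mono)
      then show ?thesis using x[of a] a(2) poly_span_add[OF c] by blast
    qed
  qed
qed simp

end

context K_operator_closed
begin

text \<open>This replaces Zariski's lemma (a field that is a finitely generated algebra over an
  algebraically closed field \<open>K\<close> equals \<open>K\<close>). It is stated for operators \<open>S c\<close> that shift the
  spanning vectors up to scalars, since this is how the noncommuting monomials \<open>y\<^sup>j g\<close> act.

  If all \<open>T - k\<close> are bijective, the space is torsion-free and divisible over \<open>K[T]\<close>. It cannot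
  be so, because it is generically free. Call \<open>\<mu>\<close> bad if some nonzero multiple \<open>d(T) e \<mu>\<close> lies
  in the \<open>K[T]\<close>-span of the \<open>e a\<close> with \<open>a < \<mu>\<close>. Applying \<open>S c\<close> shifts such a relation from
  \<open>\<mu>\<close> to \<open>c + \<mu>\<close>, so by Dickson's lemma one polynomial \<open>f \<noteq> 0\<close> serves as \<open>d\<close> for all bad
  \<open>\<mu>\<close>. After inverting \<open>f\<close>, the \<open>e \<mu>\<close> with \<open>\<mu>\<close> not bad are a basis. There
  is at least one such \<open>\<mu>\<close>, and if \<open>k\<close> is not a root of \<open>f\<close>, then \<open>e \<mu>\<close> is not divisible by
  \<open>T - k\<close>.\<close>

theorem some_translate_not_bijective:
  fixes e :: "nat list \<Rightarrow> 'v"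
  assumes nonzero: "carrier V \<noteq> {\<zero>}"
    and e: "\<And>a. length a = r \<Longrightarrow> e a \<in> carrier V"
    and span: "carrier V \<subseteq> poly_span (e ` {a. length a = r})"
    and S: "\<And>c. length c = r \<Longrightarrow> linear_map V scale V scale (S c)"
    and ST: "\<And>c u. length c = r \<Longrightarrow> u \<in> carrier V \<Longrightarrow> S c (T u) = T (S c u)"
    and Se: "\<And>c a. length c = r \<Longrightarrow> length a = r \<Longrightarrow> S c (e a) = scale (t c a) (e (map2 (+) c a))"
    and t: "\<And>c a. length c = r \<Longrightarrow> length a = r \<Longrightarrow> t c a \<noteq> 0"
  shows "\<exists>k. (\<exists>u\<in>carrier V. u \<noteq> \<zero> \<and> T u = scale k u) \<or> (\<exists>w\<in>carrier V. \<forall>u\<in>carrier V. T u \<ominus> scale k u \<noteq> w)"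
proof (rule ccontr)
  assume neg: "\<not> ?thesis"
  then have noeig: "\<And>a u. u \<in> carrier V \<Longrightarrow> T u = scale a u \<Longrightarrow> u = \<zero>"
    and onto: "\<And>a w. w \<in> carrier V \<Longrightarrow> \<exists>u\<in>carrier V. T u \<ominus> scale a u = w" by blast+
  have tf: "u = \<zero>" if "p \<noteq> 0" "u \<in> carrier V" "p \<star> u = \<zero>" for p u
    using torsion_free_if_no_eigenvector[of p u] noeig that by blast
  let ?L = "{a. length a = r}" and ?lt = "lex (less_than :: (nat \<times> nat) set)"
  define below where "below \<mu> = e ` {a \<in> ?L. (a, \<mu>) \<in> ?lt}" for \<mu>
  define upto where "upto \<mu> = e ` {a \<in> ?L. a = \<mu> \<or> (a, \<mu>) \<in> ?lt}" for \<mu>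
  have bc: "below \<mu> \<subseteq> carrier V" for \<mu> using e by (auto simp: below_def)
  have uc: "upto \<mu> \<subseteq> carrier V" for \<mu> using e by (auto simp: upto_def)
  have upto_below: "upto \<nu> \<subseteq> below \<mu>" if "(\<nu>, \<mu>) \<in> ?lt" for \<nu> \<mu>
    using that lex_transI[OF trans_less_than] by (auto simp: upto_def below_def dest: transD)
  have below_cases: "w = \<zero> \<or> (\<exists>\<nu>\<in>?L. (\<nu>, \<mu>) \<in> ?lt \<and> w \<in> poly_span (upto \<nu>))"
    if "w \<in> poly_span (below \<mu>)" for w \<mu>
    using poly_span_initial_segment[of "{a \<in> ?L. (a, \<mu>) \<in> ?lt}" r e w] that e
    unfolding below_def upto_def by auto
  have upto_split: "\<exists>d w'. w' \<in> poly_span (below \<nu>) \<and> w = d \<star> e \<nu> \<oplus> w'"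
    if "w \<in> poly_span (upto \<nu>)" "\<nu> \<in> ?L" for w \<nu>
    using that(1)
  proof (induction rule: poly_span.induct)
    case zero
    show ?case by (intro exI[of _ 0] exI[of _ \<zero>]) (simp add: poly_span.zero)
  next
    case (step w x p)
    then obtain d w' where w: "w' \<in> poly_span (below \<nu>)" "w = d \<star> e \<nu> \<oplus> w'" by blast
    have cl: "w' \<in> carrier V" "e \<nu> \<in> carrier V" using poly_span_closed[OF bc] w e that(2) by auto
    obtain a where a: "x = e a" "a \<in> ?L" "a = \<nu> \<or> (a, \<nu>) \<in> ?lt" using step by (auto simp: upto_def)
    show ?case
    proof (cases "a = \<nu>")
      case True
      then show ?thesis using w cl a
        by (intro exI[of _ "p + d"] exI[of _ w']) (simp add: act_add_left a_assoc)
    next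
      case False
      then have "x \<in> below \<nu>" using a by (auto simp: below_def)
      then have "p \<star> x \<oplus> w' \<in> poly_span (below \<nu>)" using w by (intro poly_span.step)
      moreover have "p \<star> x \<oplus> w = d \<star> e \<nu> \<oplus> (p \<star> x \<oplus> w')"
        using cl a e w by (simp add: a_lcomm)
      ultimately show ?thesis by blast
    qed
  qed
  \<comment> \<open>The multipliers of the finitely many minimal bad indices are combined into one \<open>f\<close>.\<close>
  define bad where "bad = {\<mu> \<in> ?L. \<exists>d. d \<noteq> 0 \<and> d \<star> e \<mu> \<in> poly_span (below \<mu>)}"
  obtain F where F: "finite F" "F \<subseteq> bad" "\<And>u. u \<in> bad \<Longrightarrow> \<exists>f\<in>F. list_all2 (\<le>) f u"
    using dickson[of bad r] by (auto simp: bad_def)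
  have "\<forall>\<phi>\<in>F. \<exists>d. d \<noteq> 0 \<and> d \<star> e \<phi> \<in> poly_span (below \<phi>)" using F(2) by (auto simp: bad_def)
  then obtain d where d: "\<And>\<phi>. \<phi> \<in> F \<Longrightarrow> d \<phi> \<noteq> 0" "\<And>\<phi>. \<phi> \<in> F \<Longrightarrow> d \<phi> \<star> e \<phi> \<in> poly_span (below \<phi>)"
    by metis
  define f where "f = prod d F"
  have f0: "f \<noteq> 0" using d(1) F(1) by (simp add: f_def)
  have f_bad: "f \<star> e \<mu> \<in> poly_span (below \<mu>)" if \<mu>: "\<mu> \<in> bad" for \<mu>
  proof -
    obtain \<phi> where \<phi>: "\<phi> \<in> F" "list_all2 (\<le>) \<phi> \<mu>" using F(3)[OF \<mu>] by blast
    define c where "c = map2 (-) \<mu> \<phi>"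
    have c: "\<mu> = map2 (+) c \<phi>" "length c = r" "length \<phi> = r" "length \<mu> = r"
      using list_all2_le_imp_sum[OF \<phi>(2)] \<mu> list_all2_lengthD[OF \<phi>(2)] by (auto simp: c_def bad_def)
    have "S c (d \<phi> \<star> e \<phi>) \<in> poly_span (below \<mu>)"
    proof (rule poly_span_image[OF S[OF c(2)] ST[OF c(2)] bc bc _ d(2)[OF \<phi>(1)]])
      fix p x assume "x \<in> below \<phi>"
      then obtain a where a: "x = e a" "length a = r" "(a, \<phi>) \<in> ?lt" by (auto simp: below_def)
      then have "e (map2 (+) c a) \<in> below \<mu>" using c lex_map2_add[of c a \<phi>] by (auto simp: below_def)
      then have "(p * [:t c a:]) \<star> e (map2 (+) c a) \<in> poly_span (below \<mu>)" by (intro poly_span_base bc)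
      then show "p \<star> S c x \<in> poly_span (below \<mu>)" using a c e by (simp add: Se act_mult act_scale act_smult)
    qed simp
    moreover have "S c (d \<phi> \<star> e \<phi>) = [:t c \<phi>:] \<star> d \<phi> \<star> e \<mu>"
      using c e by (simp add: act_linear_map[OF S ST] Se act_scale)
    ultimately have *: "[:t c \<phi>:] \<star> d \<phi> \<star> e \<mu> \<in> poly_span (below \<mu>)" by simp
    have "d \<phi> \<star> e \<mu> \<in> poly_span (below \<mu>)"
      using poly_span_act[OF bc *, of "[:inverse (t c \<phi>):]"] c e t[OF c(2,3)]
      by (simp add: scale_scale)
    moreover obtain g where "f = g * d \<phi>"
      using F(1) \<phi>(1) by (metis dvdE dvd_prodI f_def mult.commute)
    ultimately show ?thesis using c e poly_span_act[OF bc, of "d \<phi> \<star> e \<mu>" \<mu> g] by (simp add: act_mult)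
  qed
  have wf: "wf ?lt" by auto
  \<comment> \<open>If every index were bad, all \<open>e \<mu>\<close> would vanish by torsion-freeness, starting from the
    least index, whose relation says \<open>f(T) e \<mu> = 0\<close>.\<close>
  have "\<exists>\<mu>\<in>?L. \<mu> \<notin> bad"
  proof (rule ccontr)
    assume all: "\<not> (\<exists>\<mu>\<in>?L. \<mu> \<notin> bad)"
    have "length \<mu> = r \<longrightarrow> e \<mu> = \<zero>" for \<mu>
    proof (induction \<mu> rule: wf_induct_rule[OF wf])
      case (1 \<mu>)
      show ?case
      proof
        assume \<mu>: "length \<mu> = r"
        have "below \<mu> \<subseteq> {\<zero>}" using 1 by (auto simp: below_def)
        moreover have "w \<in> poly_span E \<Longrightarrow> E \<subseteq> {\<zero>} \<Longrightarrow> w = \<zero>" for w E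
          by (induction rule: poly_span.induct) auto
        moreover have "f \<star> e \<mu> \<in> poly_span (below \<mu>)" using all \<mu> f_bad by auto
        ultimately have "f \<star> e \<mu> = \<zero>" by blast
        then show "e \<mu> = \<zero>" using tf[OF f0] e \<mu> by blast
      qed
    qed
    then have "e ` ?L \<subseteq> {\<zero>}" by auto
    moreover have "w \<in> poly_span E \<Longrightarrow> E \<subseteq> {\<zero>} \<Longrightarrow> w = \<zero>" for w E
      by (induction rule: poly_span.induct) auto
    ultimately show False using nonzero span by blast
  qed
  then obtain \<mu> where \<mu>: "\<mu> \<in> ?L" "\<mu> \<notin> bad" by blast
  have std: "d = 0" if "d \<star> e \<nu> \<in> poly_span (below \<nu>)" "\<nu> \<in> ?L" "\<nu> \<notin> bad" for d \<nu>
    using that by (auto simp: bad_def)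
  \<comment> \<open>The contradiction comes from a solution \<open>u\<close> of \<open>(T - k) u = e \<mu>\<close>. Since \<open>f\<close> has to be
    inverted, the leading index of \<open>u\<close> means the least \<open>\<nu>\<close> such that some \<open>f(T)\<^sup>j u\<close> lies in
    the span up to \<open>\<nu>\<close>; no \<open>\<nu>\<close> can play this part.\<close>
  have "finite {k. poly f k = 0}" using f0 by (rule poly_roots_finite)
  then obtain k where k: "poly f k \<noteq> 0"
    using infinite_UNIV_char_0[where ?'a='k] by (metis (mono_tags, lifting) finite_subset mem_Collect_eq subsetI)
  obtain u where u: "u \<in> carrier V" "[:- k, 1:] \<star> u = e \<mu>"
    using onto[of "e \<mu>" k] e \<mu> by (auto simp: act_linear_factor)
  have "\<not> (\<exists>j. f ^ j \<star> u \<in> poly_span (upto \<nu>))" if "\<nu> \<in> ?L" for \<nu>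
    using that
  proof (induction \<nu> rule: wf_induct_rule[OF wf])
    case (1 \<nu>)
    show ?case
    proof
      assume "\<exists>j. f ^ j \<star> u \<in> poly_span (upto \<nu>)"
      then obtain j where j: "f ^ j \<star> u \<in> poly_span (upto \<nu>)" ..
      have e\<nu>: "e \<nu> \<in> carrier V" and e\<mu>: "e \<mu> \<in> carrier V" using e 1 \<mu> by auto
      have lower: False if "f ^ i \<star> u \<in> poly_span (below \<nu>)" for i
      proof -
        from below_cases[OF that] 1 have "f ^ i \<star> u = \<zero>" by blast
        then have "u = \<zero>" using tf[of "f ^ i" u] u f0 by simp
        then have "e \<mu> = \<zero>" using u by (metis act_zero_right)
        then show False using std[of 1 \<mu>] \<mu> by (simp add: poly_span.zero)
      qed
      from j upto_split 1 obtain c w where w: "w \<in> poly_span (below \<nu>)" "f ^ j \<star> u = c \<star> e \<nu> \<oplus> w"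
        by blast
      have wc: "w \<in> carrier V" using poly_span_closed[OF bc] w by blast
      have eq: "f ^ j \<star> e \<mu> = ([:- k, 1:] * c) \<star> e \<nu> \<oplus> [:- k, 1:] \<star> w"
      proof -
        have "f ^ j \<star> e \<mu> = [:- k, 1:] \<star> f ^ j \<star> u" using u act_commute by metis
        then show ?thesis using w e\<nu> wc by (simp add: act_add_right act_mult del: mult_pCons_left)
      qed
      have w': "[:- k, 1:] \<star> w \<in> poly_span (below \<nu>)" using w by (intro poly_span_act bc)
      from lex_total[of \<mu> \<nu>] 1 \<mu> consider "\<nu> = \<mu>" | "(\<mu>, \<nu>) \<in> ?lt" | "(\<nu>, \<mu>) \<in> ?lt" by auto
      then show False
      proof cases
        \<comment> \<open>For \<open>\<nu> = \<mu>\<close>, comparing coefficients gives \<open>f ^ j = (X - k) c\<close>, which fails at \<open>k\<close>.\<close>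
        case 1
        have "(f ^ j - [:- k, 1:] * c) \<star> e \<mu> = [:- k, 1:] \<star> w"
        proof -
          have "f ^ j = [:- k, 1:] * c + (f ^ j - [:- k, 1:] * c)" by simp
          then have "([:- k, 1:] * c) \<star> e \<mu> \<oplus> (f ^ j - [:- k, 1:] * c) \<star> e \<mu>
              = ([:- k, 1:] * c) \<star> e \<mu> \<oplus> [:- k, 1:] \<star> w"
            using act_add_left[OF e\<mu>] eq 1 by metis
          then show ?thesis using e\<mu> wc by (metis act_closed add.l_cancel)
        qed
        then have "f ^ j - [:- k, 1:] * c = 0" using std[of _ \<mu>] w' 1 \<mu> by metis
        then have "poly (f ^ j) k = poly ([:- k, 1:] * c) k" by simp
        then show False using k by simp
      next
        \<comment> \<open>For \<open>\<nu> > \<mu>\<close>, the coefficient at \<open>\<nu>\<close> cancels or, if \<open>\<nu>\<close> is bad, is absorbed by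
          \<open>f\<close>, so \<open>\<nu>\<close> was not least.\<close>
        case 2
        then have "e \<mu> \<in> below \<nu>" using \<mu> by (auto simp: below_def)
        then have "f ^ j \<star> e \<mu> \<in> poly_span (below \<nu>)" by (intro poly_span_base bc)
        moreover have "([:- k, 1:] * c) \<star> e \<nu> = \<ominus> ([:- k, 1:] \<star> w) \<oplus> f ^ j \<star> e \<mu>"
          unfolding eq using e\<nu> wc by (subst a_comm[of _ "[:- k, 1:] \<star> w"]) (simp_all only: act_closed r_neg1)
        ultimately have *: "([:- k, 1:] * c) \<star> e \<nu> \<in> poly_span (below \<nu>)"
          using w' by (simp add: poly_span_add poly_span_minus bc del: mult_pCons_left)
        show False
        proof (cases "\<nu> \<in> bad")
          case True
          have "f ^ Suc j \<star> u = c \<star> f \<star> e \<nu> \<oplus> f \<star> w"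
            using w u e\<nu> wc by (simp add: act_mult act_add_right act_commute[of _ c])
          moreover have "c \<star> f \<star> e \<nu> \<oplus> f \<star> w \<in> poly_span (below \<nu>)"
            by (rule poly_span_add[OF bc poly_span_act[OF bc w(1)] poly_span_act[OF bc f_bad[OF True]]])
          ultimately show False using lower by metis
        next
          case False
          then have "[:- k, 1:] * c = 0" using std[OF *] 1 \<open>\<nu> \<in> ?L\<close> by blast
          then have "c = 0" by (metis mult_eq_0_iff pCons_eq_0_iff one_neq_zero)
          then show False using w wc lower[of j] by simp
        qed
      next
        \<comment> \<open>For \<open>\<nu> < \<mu>\<close>, \<open>f(T)\<^sup>j e \<mu>\<close> is in the span below \<open>\<mu>\<close>, although \<open>\<mu>\<close> is not bad.\<close>
        case 3
        have "f ^ j \<star> e \<mu> \<in> poly_span (upto \<nu>)"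
          using poly_span_act[OF uc j, of "[:- k, 1:]"] u act_commute by metis
        then have "f ^ j \<star> e \<mu> \<in> poly_span (below \<mu>)" using upto_below[OF 3] poly_span_mono by blast
        then show False using std[of "f ^ j" \<mu>] f0 \<mu> by simp
      qed
    qed
  qed
  moreover have "u = \<zero> \<or> (\<exists>\<nu>\<in>?L. u \<in> poly_span (upto \<nu>))"
    using poly_span_initial_segment[of ?L r e u] span u e unfolding upto_def by auto
  moreover have "u \<noteq> \<zero>"
  proof
    assume "u = \<zero>"
    then have "e \<mu> = \<zero>" using u by (metis act_zero_right)
    then show False using std[of 1 \<mu>] \<mu> by (simp add: poly_span.zero)
  qed
  ultimately show False using u by (metis act_1 power_0)
qed

end

section \<open>Modules over the skew group ring\<close>

lemma skew_ring_carrier: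
  "f \<in> carrier (skew_ring G \<chi> \<eta>) \<longleftrightarrow> Poly_Mapping.keys f \<subseteq> UNIV \<times> UNIV \<times> carrier G"
  by (simp add: skew_ring_def)

lemma skew_ring_simps [simp]:
  "f \<oplus>\<^bsub>skew_ring G \<chi> \<eta>\<^esub> f' = f + f'"
  "f \<otimes>\<^bsub>skew_ring G \<chi> \<eta>\<^esub> f' = skew_mult G \<chi> \<eta> f f'"
  "\<zero>\<^bsub>skew_ring G \<chi> \<eta>\<^esub> = 0"
  "\<one>\<^bsub>skew_ring G \<chi> \<eta>\<^esub> = elt_scalar G 1"
  by (simp_all add: skew_ring_def elt_scalar_def)

lemma elt_scalar_add: "elt_scalar G (a + a') = elt_scalar G a + elt_scalar G a'"
  by (simp add: elt_scalar_def single_add)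

locale skew_module =
  G: comm_group G + H: left_module "skew_ring G \<chi> \<eta>" M
  for G :: "('g, 'm) monoid_scheme" and \<chi> \<eta> :: "'g \<Rightarrow> 'k::field"
    and M :: "(('g, 'k) skew, 'v, 'd) module_scheme" +
  assumes chi: "\<chi> \<in> hom G Kx" and eta: "\<eta> \<in> hom G Kx"
begin

abbreviation R where "R \<equiv> skew_ring G \<chi> \<eta>"
abbreviation smul where "smul a u \<equiv> elt_scalar G a \<odot>\<^bsub>M\<^esub> u"

lemmas char_ones [simp] = char_one[OF chi G.is_group] char_one[OF eta G.is_group]

lemma single_closed [simp]: "g \<in> carrier G \<Longrightarrow> Poly_Mapping.single (i, j, g) a \<in> carrier R"
  by (auto simp: skew_ring_carrier split: if_splits)

lemma elt_closed [simp]: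
  "elt_x G \<in> carrier R" "elt_y G \<in> carrier R" "elt_scalar G a \<in> carrier R"
  "g \<in> carrier G \<Longrightarrow> elt_grp g \<in> carrier R"
  by (simp_all add: elt_x_def elt_y_def elt_scalar_def elt_grp_def)

lemma add_closed: "r \<in> carrier R \<Longrightarrow> s \<in> carrier R \<Longrightarrow> r + s \<in> carrier R"
  using keys_add[of r s] by (auto simp: skew_ring_carrier)

lemma mult_closed: "r \<in> carrier R \<Longrightarrow> s \<in> carrier R \<Longrightarrow> skew_mult G \<chi> \<eta> r s \<in> carrier R"
  using skew_mult_closed[OF G.is_group] by (simp add: skew_ring_carrier)

lemma smult_closed [simp]: "r \<in> carrier R \<Longrightarrow> u \<in> carrier M \<Longrightarrow> r \<odot>\<^bsub>M\<^esub> u \<in> carrier M"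
  by (rule H.smult_closed)

lemma smult_mult:
  "r \<in> carrier R \<Longrightarrow> s \<in> carrier R \<Longrightarrow> u \<in> carrier M \<Longrightarrow> skew_mult G \<chi> \<eta> r s \<odot>\<^bsub>M\<^esub> u = r \<odot>\<^bsub>M\<^esub> (s \<odot>\<^bsub>M\<^esub> u)"
  using H.smult_assoc[of r s u] by simp

lemma smult_add: "r \<in> carrier R \<Longrightarrow> s \<in> carrier R \<Longrightarrow> u \<in> carrier M \<Longrightarrow> (r + s) \<odot>\<^bsub>M\<^esub> u = r \<odot>\<^bsub>M\<^esub> u \<oplus>\<^bsub>M\<^esub> s \<odot>\<^bsub>M\<^esub> u"
  using H.smult_l_distr[of r s u] by simp

sublocale K_space M smul
proof (intro_locales, unfold_locales)
  fix u a a' assume u: "u \<in> carrier M"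
  show "smul (a + a') u = smul a u \<oplus>\<^bsub>M\<^esub> smul a' u"
    using u by (simp add: elt_scalar_add smult_add)
  show "smul 1 u = u" using H.smult_one[OF u] by simp
  have "skew_mult G \<chi> \<eta> (elt_scalar G a) (elt_scalar G a') = elt_scalar G (a * a')"
    by (simp add: elt_scalar_def skew_mult_single)
  then show "smul a (smul a' u) = smul (a * a') u"
    using smult_mult[of "elt_scalar G a" "elt_scalar G a'" u] u by simp
  show "smul a u \<in> carrier M" using u by simp
next
  fix u w a assume "u \<in> carrier M" "w \<in> carrier M"
  then show "smul a (u \<oplus>\<^bsub>M\<^esub> w) = smul a u \<oplus>\<^bsub>M\<^esub> smul a w"
    by (intro H.smult_r_distr) (simp_all)
qed

lemma scalar_central: "r \<in> carrier R \<Longrightarrow> skew_mult G \<chi> \<eta> (elt_scalar G a) r = skew_mult G \<chi> \<eta> r (elt_scalar G a)"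
proof -
  assume r: "r \<in> carrier R"
  have "skew_mult G \<chi> \<eta> (elt_scalar G a) (Poly_Mapping.single p a') = skew_mult G \<chi> \<eta> (Poly_Mapping.single p a') (elt_scalar G a)"
    if "p \<in> Poly_Mapping.keys r" for p a'
    using that r by (cases p) (auto simp: skew_ring_carrier elt_scalar_def skew_mult_single mult.commute)
  then show ?thesis
    by (subst (1 2) skew_expand[of r]) (simp add: skew_mult_sum_left skew_mult_sum_right)
qed

lemma linear_map_smult: "r \<in> carrier R \<Longrightarrow> linear_map M smul M smul (\<lambda>u. r \<odot>\<^bsub>M\<^esub> u)"
  unfolding linear_map_def
  using scalar_central smult_mult[of r "elt_scalar G _"] smult_mult[of "elt_scalar G _" r] H.smult_r_distr
  by (metis (no_types, lifting) Pi_I elt_closed(3) smult_closed)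

lemma abelian_M: "abelian_group M"
  by unfold_locales

lemma smult_zero [simp]: "r \<in> carrier R \<Longrightarrow> r \<odot>\<^bsub>M\<^esub> \<zero>\<^bsub>M\<^esub> = \<zero>\<^bsub>M\<^esub>"
  using linear_map_zero[OF linear_map_smult abelian_M] .

lemma smult_smul: "r \<in> carrier R \<Longrightarrow> u \<in> carrier M \<Longrightarrow> r \<odot>\<^bsub>M\<^esub> smul a u = smul a (r \<odot>\<^bsub>M\<^esub> u)"
  using linear_map_scale[OF linear_map_smult] .

lemma smult_plus: "r \<in> carrier R \<Longrightarrow> u \<in> carrier M \<Longrightarrow> w \<in> carrier M \<Longrightarrow> r \<odot>\<^bsub>M\<^esub> (u \<oplus>\<^bsub>M\<^esub> w) = r \<odot>\<^bsub>M\<^esub> u \<oplus>\<^bsub>M\<^esub> r \<odot>\<^bsub>M\<^esub> w"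
  using linear_map_add[OF linear_map_smult] .

lemma single_single_smult:
  assumes "p \<in> UNIV \<times> UNIV \<times> carrier G" "p' \<in> UNIV \<times> UNIV \<times> carrier G" "u \<in> carrier M"
  shows "Poly_Mapping.single p 1 \<odot>\<^bsub>M\<^esub> (Poly_Mapping.single p' 1 \<odot>\<^bsub>M\<^esub> u) =
    smul (twist \<chi> \<eta> p p') (Poly_Mapping.single (basis_mult G p p') 1 \<odot>\<^bsub>M\<^esub> u)"
proof -
  obtain i j g i' j' g' where p: "p = (i, j, g)" "p' = (i', j', g')" by (cases p; cases p')
  have g: "g \<in> carrier G" "g' \<in> carrier G" using assms p by auto
  have "Poly_Mapping.single p 1 \<odot>\<^bsub>M\<^esub> (Poly_Mapping.single p' 1 \<odot>\<^bsub>M\<^esub> u)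
      = skew_mult G \<chi> \<eta> (Poly_Mapping.single p 1) (Poly_Mapping.single p' 1) \<odot>\<^bsub>M\<^esub> u"
    using assms g by (subst smult_mult) (simp_all add: p)
  also have "skew_mult G \<chi> \<eta> (Poly_Mapping.single p 1) (Poly_Mapping.single p' 1)
      = skew_mult G \<chi> \<eta> (elt_scalar G (twist \<chi> \<eta> p p')) (Poly_Mapping.single (basis_mult G p p') 1)"
    using g by (simp add: p elt_scalar_def skew_mult_single)
  finally show ?thesis using assms g by (simp add: smult_mult p)
qed

lemma xy_commute: "u \<in> carrier M \<Longrightarrow> elt_x G \<odot>\<^bsub>M\<^esub> (elt_y G \<odot>\<^bsub>M\<^esub> u) = elt_y G \<odot>\<^bsub>M\<^esub> (elt_x G \<odot>\<^bsub>M\<^esub> u)"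
  by (simp add: elt_x_def elt_y_def single_single_smult)

lemma x_grp:
  assumes "g \<in> carrier G" "u \<in> carrier M"
  shows "elt_x G \<odot>\<^bsub>M\<^esub> (elt_grp g \<odot>\<^bsub>M\<^esub> u) = smul (\<chi> g) (elt_grp g \<odot>\<^bsub>M\<^esub> (elt_x G \<odot>\<^bsub>M\<^esub> u))"
  using assms char_nonzero[OF chi]
  by (simp add: elt_x_def elt_grp_def single_single_smult scale_scale)

lemma y_grp:
  assumes "g \<in> carrier G" "u \<in> carrier M"
  shows "elt_y G \<odot>\<^bsub>M\<^esub> (elt_grp g \<odot>\<^bsub>M\<^esub> u) = smul (\<eta> g) (elt_grp g \<odot>\<^bsub>M\<^esub> (elt_y G \<odot>\<^bsub>M\<^esub> u))"
  using assms char_nonzero[OF eta]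
  by (simp add: elt_y_def elt_grp_def single_single_smult scale_scale)

lemma grp_grp:
  "g \<in> carrier G \<Longrightarrow> h \<in> carrier G \<Longrightarrow> u \<in> carrier M \<Longrightarrow>
   elt_grp g \<odot>\<^bsub>M\<^esub> (elt_grp h \<odot>\<^bsub>M\<^esub> u) = elt_grp (g \<otimes>\<^bsub>G\<^esub> h) \<odot>\<^bsub>M\<^esub> u"
  by (simp add: elt_grp_def single_single_smult)

lemma grp_one: "u \<in> carrier M \<Longrightarrow> elt_grp \<one>\<^bsub>G\<^esub> \<odot>\<^bsub>M\<^esub> u = u"
  using scale_one by (simp add: elt_grp_def elt_scalar_def)

lemma grp_inj:
  assumes g: "g \<in> carrier G" and u: "u \<in> carrier M" and "elt_grp g \<odot>\<^bsub>M\<^esub> u = \<zero>\<^bsub>M\<^esub>"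
  shows "u = \<zero>\<^bsub>M\<^esub>"
  using grp_grp[of "inv\<^bsub>G\<^esub> g" g u] assms grp_one by simp

lemma skew_ring_induct [consumes 1, case_names add mult scalar x y grp]:
  assumes r: "r \<in> carrier R"
    and add: "\<And>r s. r \<in> carrier R \<Longrightarrow> s \<in> carrier R \<Longrightarrow> P r \<Longrightarrow> P s \<Longrightarrow> P (r + s)"
    and mult: "\<And>r s. r \<in> carrier R \<Longrightarrow> s \<in> carrier R \<Longrightarrow> P r \<Longrightarrow> P s \<Longrightarrow> P (skew_mult G \<chi> \<eta> r s)"
    and scalar: "\<And>a. P (elt_scalar G a)"
    and x: "P (elt_x G)" and y: "P (elt_y G)" and grp: "\<And>g. g \<in> carrier G \<Longrightarrow> P (elt_grp g)"
  shows "P r"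
proof -
  have pow: "s [^]\<^bsub>R\<^esub> k \<in> carrier R \<and> P (s [^]\<^bsub>R\<^esub> k)" if "s \<in> carrier R" "P s" for s and k :: nat
    by (induction k) (use that mult scalar in \<open>auto simp: mult_closed\<close>)
  have single: "P (Poly_Mapping.single p a)" if pr: "p \<in> Poly_Mapping.keys r" for p a
  proof -
    obtain i j g where p: "p = (i, j, g)" by (cases p)
    have g: "g \<in> carrier G" using pr r p by (auto simp: skew_ring_carrier)
    have "P (elt_scalar G a \<otimes>\<^bsub>R\<^esub> (elt_x G [^]\<^bsub>R\<^esub> i \<otimes>\<^bsub>R\<^esub> (elt_y G [^]\<^bsub>R\<^esub> j \<otimes>\<^bsub>R\<^esub> elt_grp g)))"
      using pow[OF _ x] pow[OF _ y] mult scalar grp[OF g] g mult_closed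
      by simp
    then show ?thesis
      unfolding p using skew_ring_relations(5)[OF G.is_group chi eta g g] by metis
  qed
  have "K \<subseteq> Poly_Mapping.keys r \<Longrightarrow> (\<Sum>p\<in>K. Poly_Mapping.single p (Poly_Mapping.lookup r p)) \<in> carrier R
      \<and> P (\<Sum>p\<in>K. Poly_Mapping.single p (Poly_Mapping.lookup r p))" for K
  proof (induction K rule: infinite_finite_induct)
    case (infinite K)
    then show ?case using scalar[of 0] elt_closed(3)[of 0] by (simp add: elt_scalar_def)
  next
    case empty
    then show ?case using scalar[of 0] elt_closed(3)[of 0] by (simp add: elt_scalar_def)
  next
    case (insert p K)
    obtain i j g where p: "p = (i, j, g)" by (cases p)
    have "g \<in> carrier G" using insert.prems r p by (auto simp: skew_ring_carrier)
    then have c: "Poly_Mapping.single p (Poly_Mapping.lookup r p) \<in> carrier R" unfolding p by (rule single_closed)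
    show ?case using insert add[OF c _ single] add_closed[OF c] by simp
  qed
  then show ?thesis using skew_expand[of r] by (metis order_refl)
qed

lemma submoduleI:
  assumes N: "N \<subseteq> carrier M" "\<zero>\<^bsub>M\<^esub> \<in> N"
    and add: "\<And>u w. u \<in> N \<Longrightarrow> w \<in> N \<Longrightarrow> u \<oplus>\<^bsub>M\<^esub> w \<in> N"
    and smult: "\<And>r u. r \<in> carrier R \<Longrightarrow> u \<in> N \<Longrightarrow> r \<odot>\<^bsub>M\<^esub> u \<in> N"
  shows "submodule N R M"
proof
  fix u assume u: "u \<in> N"
  have "\<ominus>\<^bsub>M\<^esub> u = smul (- 1) u" using u N by (auto simp: scale_minus)
  then have "\<ominus>\<^bsub>M\<^esub> u \<in> N" using smult[OF elt_closed(3) u] by simp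
  then show "inv\<^bsub>add_monoid M\<^esub> u \<in> N" by (simp add: a_inv_def)
qed (use assms in \<open>auto\<close>)

end

section \<open>Words in finitely generated abelian groups\<close>

fun word :: "('g, 'm) monoid_scheme \<Rightarrow> 'g list \<Rightarrow> nat list \<Rightarrow> 'g" where
  "word G (g # gs) (k # ks) = g [^]\<^bsub>G\<^esub> k \<otimes>\<^bsub>G\<^esub> word G gs ks"
| "word G _ _ = \<one>\<^bsub>G\<^esub>"

context comm_group
begin

lemma word_closed [simp]: "set gs \<subseteq> carrier G \<Longrightarrow> word G gs ks \<in> carrier G"
  by (induction gs ks rule: list_induct2') auto

lemma word_add:
  "length ks = length gs \<Longrightarrow> length ls = length gs \<Longrightarrow> set gs \<subseteq> carrier G \<Longrightarrow>
   word G gs (map2 (+) ks ls) = word G gs ks \<otimes> word G gs ls"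
proof (induction gs arbitrary: ks ls)
  case (Cons g gs)
  then obtain k ks' l ls' where "ks = k # ks'" "ls = l # ls'" by (auto simp: length_Suc_conv)
  with Cons show ?case by (simp add: nat_pow_mult[symmetric] m_ac)
qed simp

lemma word_replicate_0: "set gs \<subseteq> carrier G \<Longrightarrow> word G gs (replicate (length gs) 0) = \<one>"
  by (induction gs) auto

lemma word_generator: "set gs \<subseteq> carrier G \<Longrightarrow> g \<in> set gs \<Longrightarrow> \<exists>ks. length ks = length gs \<and> word G gs ks = g"
proof (induction gs)
  case (Cons a gs)
  show ?case
  proof (cases "g = a")
    case True
    then show ?thesis using Cons.prems
      by (intro exI[of _ "1 # replicate (length gs) 0"]) (auto simp: word_replicate_0)
  next
    case False
    then obtain ks where "length ks = length gs" "word G gs ks = g" using Cons by auto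
    then show ?thesis using Cons.prems by (intro exI[of _ "0 # ks"]) auto
  qed
qed simp

text \<open>Exponents are natural numbers, so the inverses of the generators are added to the list. The
  words are then indexed by exponent vectors, to which Dickson's lemma applies.\<close>

lemma finitely_generated_words:
  assumes "finitely_generated_group G"
  obtains gs where "set gs \<subseteq> carrier G"
    "\<And>g. g \<in> carrier G \<Longrightarrow> \<exists>ks. length ks = length gs \<and> word G gs ks = g"
proof -
  obtain S where S: "finite S" "S \<subseteq> carrier G" "generate G S = carrier G"
    using assms by (auto simp: finitely_generated_group_def)
  obtain gs where gs: "set gs = S \<union> m_inv G ` S" using S(1) finite_list[of "S \<union> m_inv G ` S"] by auto
  have c: "set gs \<subseteq> carrier G" using gs S(2) by auto
  have "\<exists>ks. length ks = length gs \<and> word G gs ks = g" if "g \<in> generate G S" for g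
    using that
  proof induction
    case one
    show ?case using word_replicate_0[OF c] by (intro exI[of _ "replicate (length gs) 0"]) simp
  next
    case (incl h)
    then show ?case using word_generator[OF c] gs by auto
  next
    case (inv h)
    then show ?case using word_generator[OF c] gs by auto
  next
    case (eng h h')
    then obtain ks ks' where "length ks = length gs" "word G gs ks = h" "length ks' = length gs" "word G gs ks' = h'"
      by auto
    then show ?case using word_add[of ks gs ks'] c by (intro exI[of _ "map2 (+) ks ks'"]) auto
  qed
  then show ?thesis using that c S(3) by auto
qed

end

section \<open>Simple modules\<close>

context skew_module
begin

lemma simple_carrier_if_nonzero:
  assumes "simple_left_module R M" "submodule N R M" "u \<in> N" "u \<noteq> \<zero>\<^bsub>M\<^esub>"
  shows "N = carrier M"
  using assms by (auto simp: simple_left_module_def)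

lemma schur:
  assumes simple: "simple_left_module R M"
    and f: "linear_map M smul M smul f"
    and comm: "\<And>r u. r \<in> carrier R \<Longrightarrow> u \<in> carrier M \<Longrightarrow> f (r \<odot>\<^bsub>M\<^esub> u) = r \<odot>\<^bsub>M\<^esub> f u"
  shows "(\<forall>u\<in>carrier M. f u = \<zero>\<^bsub>M\<^esub>) \<or>
    (\<forall>u\<in>carrier M. f u = \<zero>\<^bsub>M\<^esub> \<longrightarrow> u = \<zero>\<^bsub>M\<^esub>) \<and> f ` carrier M = carrier M"
proof -
  note f0 = linear_map_zero[OF f abelian_M]
  have ker: "submodule {u \<in> carrier M. f u = \<zero>\<^bsub>M\<^esub>} R M"
    using f0 by (intro submoduleI) (auto simp: linear_map_add[OF f] comm)
  have im: "submodule (f ` carrier M) R M"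
  proof (rule submoduleI)
    show "f ` carrier M \<subseteq> carrier M" using linear_map_closed[OF f] by auto
    show "\<zero>\<^bsub>M\<^esub> \<in> f ` carrier M" using f0 by (metis H.zero_closed image_eqI)
    show "u \<oplus>\<^bsub>M\<^esub> w \<in> f ` carrier M" if "u \<in> f ` carrier M" "w \<in> f ` carrier M" for u w
      using that by (auto simp: linear_map_add[OF f, symmetric])
    show "r \<odot>\<^bsub>M\<^esub> u \<in> f ` carrier M" if "r \<in> carrier R" "u \<in> f ` carrier M" for r u
      using that by (auto simp: comm[symmetric])
  qed
  show ?thesis
    using simple_carrier_if_nonzero[OF simple ker] simple_carrier_if_nonzero[OF simple im] linear_map_closed[OF f]
    by blast
qed

text \<open>As \<open>x\<close> commutes with the generators up to scalars, its kernel is a submodule; torsion makes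
  it nonzero.\<close>

lemma x_eq_zero_if_torsion:
  assumes simple: "simple_left_module R M" and tor: "torsion_wrt R (elt_x G) M" and u: "u \<in> carrier M"
  shows "elt_x G \<odot>\<^bsub>M\<^esub> u = \<zero>\<^bsub>M\<^esub>"
proof -
  let ?N = "{u \<in> carrier M. elt_x G \<odot>\<^bsub>M\<^esub> u = \<zero>\<^bsub>M\<^esub>}"
  have "\<forall>u\<in>?N. r \<odot>\<^bsub>M\<^esub> u \<in> ?N" if "r \<in> carrier R" for r
    using that
    by (induction rule: skew_ring_induct)
      (auto simp: smult_add smult_mult smult_plus smult_smul xy_commute x_grp)
  then have sub: "submodule ?N R M"
    by (intro submoduleI) (auto simp: smult_plus)
  have pow: "elt_x G [^]\<^bsub>R\<^esub> k \<in> carrier R" for k :: nat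
    by (rule H.nat_pow_closed) simp
  have ex: "\<exists>w\<in>?N. w \<noteq> \<zero>\<^bsub>M\<^esub>"
    if "(elt_x G [^]\<^bsub>R\<^esub> k) \<odot>\<^bsub>M\<^esub> w = \<zero>\<^bsub>M\<^esub>" "w \<in> carrier M" "w \<noteq> \<zero>\<^bsub>M\<^esub>" for k :: nat and w
    using that
  proof (induction k arbitrary: w)
    case 0
    then show ?case using scale_one[of w] by simp
  next
    case (Suc k)
    have *: "(elt_x G [^]\<^bsub>R\<^esub> k) \<odot>\<^bsub>M\<^esub> (elt_x G \<odot>\<^bsub>M\<^esub> w) = \<zero>\<^bsub>M\<^esub>"
      using Suc.prems pow[of k] by (simp add: smult_mult)
    show ?case
    proof (cases "elt_x G \<odot>\<^bsub>M\<^esub> w = \<zero>\<^bsub>M\<^esub>")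
      case True
      then show ?thesis using Suc.prems(2,3) by (intro bexI[of _ w]) simp_all
    next
      case False
      show ?thesis by (rule Suc.IH[OF * _ False]) (simp add: Suc.prems(2))
    qed
  qed
  obtain w where "w \<in> carrier M" "w \<noteq> \<zero>\<^bsub>M\<^esub>" using simple by (auto simp: simple_left_module_def)
  then obtain w' where w': "w' \<in> ?N" "w' \<noteq> \<zero>\<^bsub>M\<^esub>" using tor ex unfolding torsion_wrt_def by blast
  have "u \<in> ?N" unfolding simple_carrier_if_nonzero[OF simple sub w'] by (rule u)
  then show ?thesis by simp
qed

end

locale skew_module_closed = skew_module G \<chi> \<eta> M
  for G :: "('g, 'm) monoid_scheme" and \<chi> \<eta> :: "'g \<Rightarrow> 'k::{alg_closed_field, field_char_0}"
    and M :: "(('g, 'k) skew, 'v, 'd) module_scheme"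
begin

text \<open>By Schur's lemma each \<open>T - k\<close> is zero or bijective, where \<open>T\<close> is the action of
  \<open>y\<^sup>m h\<close>, and the task is to find one that is not bijective. As \<open>x\<close> acts by zero, the module is
  spanned by the vectors \<open>y\<^sup>j g v\<close> for a fixed \<open>v \<noteq> 0\<close>. Writing \<open>g\<close> as a word, these are indexed
  by exponent vectors, and the monomials \<open>y\<^sup>j g\<close> themselves shift the exponents up to nonzero
  scalars.\<close>

theorem central_monomial_acts_by_scalar:
  assumes fg: "finitely_generated_group G" and simple: "simple_left_module R M"
    and x: "\<And>u. u \<in> carrier M \<Longrightarrow> elt_x G \<odot>\<^bsub>M\<^esub> u = \<zero>\<^bsub>M\<^esub>"
    and h: "h \<in> carrier G" "\<eta> h = 1" and m: "\<And>g. g \<in> carrier G \<Longrightarrow> \<eta> g ^ m = 1"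
  shows "\<exists>k. \<forall>u\<in>carrier M. Poly_Mapping.single (0, m, h) 1 \<odot>\<^bsub>M\<^esub> u = smul k u"
proof -
  let ?z = "Poly_Mapping.single (0, m, h) (1::'k)"
  define T where "T u = ?z \<odot>\<^bsub>M\<^esub> u" for u
  have T: "linear_map M smul M smul T"
    unfolding T_def using h by (intro linear_map_smult single_closed)
  interpret K_operator_closed M smul T by unfold_locales (rule T)
  have comm: "\<forall>u\<in>carrier M. T (r \<odot>\<^bsub>M\<^esub> u) = r \<odot>\<^bsub>M\<^esub> T u" if "r \<in> carrier R" for r
    using that
  proof (induction rule: skew_ring_induct)
    case (scalar a)
    show ?case by (simp add: T_scale)
  next
    case x
    show ?case using assms(3) by simp
  next
    case y
    show ?case using h by (simp add: T_def elt_y_def single_single_smult)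
  next
    case (grp g)
    then show ?case using h m by (simp add: T_def elt_grp_def single_single_smult G.m_comm power_inverse)
  qed (auto simp: smult_add smult_mult smult_plus T_add)
  obtain v where v: "v \<in> carrier M" "v \<noteq> \<zero>\<^bsub>M\<^esub>" using simple by (auto simp: simple_left_module_def)
  obtain gs where gs: "set gs \<subseteq> carrier G"
    "\<And>g. g \<in> carrier G \<Longrightarrow> \<exists>ks. length ks = length gs \<and> word G gs ks = g"
    using G.finitely_generated_words[OF fg] by metis
  define r where "r = Suc (length gs)"
  define p where "p c = (0::nat, hd c, word G gs (tl c))" for c :: "nat list"
  define S where "S c u = Poly_Mapping.single (p c) (1::'k) \<odot>\<^bsub>M\<^esub> u" for c u
  define e where "e a = S a v" for a
  have pc: "p c \<in> UNIV \<times> UNIV \<times> carrier G" for c using gs by (simp add: p_def)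
  have sc: "Poly_Mapping.single (p c) (1::'k) \<in> carrier R" for c
    unfolding p_def using gs by (intro single_closed) simp
  have S: "linear_map M smul M smul (S c)" for c unfolding S_def using sc by (rule linear_map_smult)
  have ST: "S c (T u) = T (S c u)" if "u \<in> carrier M" for c u using comm[OF sc] that by (simp add: S_def)
  have ec: "e a \<in> carrier M" for a using sc v by (simp add: e_def S_def)
  have bm: "basis_mult G (p c) (p a) = p (map2 (+) c a)" if "length c = r" "length a = r" for c a
    using that G.word_add gs(1) by (auto simp: r_def p_def length_Suc_conv)
  have Se: "S c (e a) = smul (twist \<chi> \<eta> (p c) (p a)) (e (map2 (+) c a))" if "length c = r" "length a = r" for c a
    using single_single_smult[OF pc pc v(1)] bm[OF that] by (simp add: e_def S_def)
  have t0: "twist \<chi> \<eta> (p c) (p a) \<noteq> 0" for c a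
    using char_nonzero[OF chi] char_nonzero[OF eta] gs by (auto simp: p_def)
  let ?E = "e ` {a. length a = r}"
  have Ec: "?E \<subseteq> carrier M" using ec by auto
  have Sspan: "S c w \<in> poly_span ?E" if "length c = r" "w \<in> poly_span ?E" for c w
  proof (rule poly_span_image[OF S ST Ec Ec _ that(2)])
    fix q y assume "y \<in> ?E"
    then obtain a where a: "y = e a" "length a = r" by auto
    have "e (map2 (+) c a) \<in> ?E" using a that by simp
    then have "poly_act T (q * [:twist \<chi> \<eta> (p c) (p a):]) (e (map2 (+) c a)) \<in> poly_span ?E"
      by (rule poly_span_base[OF Ec])
    then show "poly_act T q (S c y) \<in> poly_span ?E"
      using a that ec by (simp add: Se act_scale act_smult)
  qed
  \<comment> \<open>The span is stable under \<open>y\<close> and \<open>g\<close> because both are monomials, so that each of them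
    acts as one of the shifts \<open>S c\<close>.\<close>
  have span_smult: "\<forall>w\<in>poly_span ?E. s \<odot>\<^bsub>M\<^esub> w \<in> poly_span ?E" if "s \<in> carrier R" for s
    using that
  proof (induction rule: skew_ring_induct)
    case (add s s')
    then show ?case using poly_span_closed[OF Ec] by (simp add: smult_add poly_span_add[OF Ec])
  next
    case (mult s s')
    then show ?case using poly_span_closed[OF Ec] by (simp add: smult_mult)
  next
    case (scalar a)
    then show ?case using poly_span_act[OF Ec, of _ "[:a:]"] poly_span_closed[OF Ec] by simp
  next
    case x
    then show ?case using assms(3) poly_span_closed[OF Ec] by (simp add: poly_span.zero)
  next
    case y
    have "S (1 # replicate (length gs) 0) = (\<lambda>u. elt_y G \<odot>\<^bsub>M\<^esub> u)"
      using gs by (simp add: S_def p_def elt_y_def G.word_replicate_0 fun_eq_iff)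
    then show ?case using Sspan[of "1 # replicate (length gs) 0"] by (auto simp: r_def)
  next
    case (grp g)
    then obtain ks where "length ks = length gs" "word G gs ks = g" using gs by blast
    then have "S (0 # ks) = (\<lambda>u. elt_grp g \<odot>\<^bsub>M\<^esub> u)" "length (0 # ks) = r"
      by (simp_all add: S_def p_def elt_grp_def r_def fun_eq_iff)
    then show ?case using Sspan[of "0 # ks"] by auto
  qed
  have "submodule (poly_span ?E) R M"
    using poly_span_closed[OF Ec] span_smult by (intro submoduleI) (auto simp: poly_span.zero poly_span_add[OF Ec])
  moreover have "v \<in> poly_span ?E"
  proof -
    have "e (replicate r 0) = v"
      using v gs scale_one[of v] by (simp add: e_def S_def p_def r_def G.word_replicate_0 elt_scalar_def)
    then show ?thesis using poly_span_base[OF Ec, of v 1] v(1) by (force)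
  qed
  ultimately have span: "carrier M \<subseteq> poly_span ?E" using simple_carrier_if_nonzero[OF simple] v by blast
  have nonzero: "carrier M \<noteq> {\<zero>\<^bsub>M\<^esub>}" using v by blast
  have "\<exists>k. (\<exists>u\<in>carrier M. u \<noteq> \<zero>\<^bsub>M\<^esub> \<and> T u = smul k u) \<or>
      (\<exists>w\<in>carrier M. \<forall>u\<in>carrier M. T u \<ominus>\<^bsub>M\<^esub> smul k u \<noteq> w)"
  proof (rule some_translate_not_bijective[where r = r and e = e and S = S
        and t = "\<lambda>c a. twist \<chi> \<eta> (p c) (p a)"])
    show "carrier M \<noteq> {\<zero>\<^bsub>M\<^esub>}" by (rule nonzero)
    show "e a \<in> carrier M" for a by (rule ec)
    show "carrier M \<subseteq> poly_span ?E" by (rule span)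
    show "linear_map M smul M smul (S c)" for c by (rule S)
    show "S c (T u) = T (S c u)" if "u \<in> carrier M" for c u using that by (rule ST)
    show "S c (e a) = smul (twist \<chi> \<eta> (p c) (p a)) (e (map2 (+) c a))"
      if "length c = r" "length a = r" for c a using that by (rule Se)
    show "twist \<chi> \<eta> (p c) (p a) \<noteq> 0" for c a by (rule t0)
  qed
  then obtain k where k: "(\<exists>u\<in>carrier M. u \<noteq> \<zero>\<^bsub>M\<^esub> \<and> T u = smul k u) \<or>
      (\<exists>w\<in>carrier M. \<forall>u\<in>carrier M. T u \<ominus>\<^bsub>M\<^esub> smul k u \<noteq> w)" by (rule exE)
  have f: "linear_map M smul M smul (\<lambda>u. poly_act T [:- k, 1:] u)" by (rule linear_map_act)
  have "poly_act T [:- k, 1:] (s \<odot>\<^bsub>M\<^esub> u) = s \<odot>\<^bsub>M\<^esub> (poly_act T [:- k, 1:] u)" if "s \<in> carrier R" "u \<in> carrier M" for s u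
    using act_linear_map[OF linear_map_smult[OF that(1)] _ that(2)] comm[OF that(1)] by simp
  note dichotomy = schur[OF simple f this]
  have "\<not> ((\<forall>u\<in>carrier M. poly_act T [:- k, 1:] u = \<zero>\<^bsub>M\<^esub> \<longrightarrow> u = \<zero>\<^bsub>M\<^esub>) \<and>
      (\<lambda>u. poly_act T [:- k, 1:] u) ` carrier M = carrier M)"
  proof
    assume bij: "(\<forall>u\<in>carrier M. poly_act T [:- k, 1:] u = \<zero>\<^bsub>M\<^esub> \<longrightarrow> u = \<zero>\<^bsub>M\<^esub>) \<and>
      (\<lambda>u. poly_act T [:- k, 1:] u) ` carrier M = carrier M"
    from k show False
    proof (elim disjE bexE conjE)
      fix u assume "u \<in> carrier M" "u \<noteq> \<zero>\<^bsub>M\<^esub>" "T u = smul k u"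
      then show False using bij act_linear_factor_eq_0[of u k] by blast
    next
      fix w assume w: "w \<in> carrier M" "\<forall>u\<in>carrier M. T u \<ominus>\<^bsub>M\<^esub> smul k u \<noteq> w"
      then obtain u where "u \<in> carrier M" "w = poly_act T [:- k, 1:] u" using bij by blast
      then show False using w(2) act_linear_factor[of u k] by metis
    qed
  qed
  then have "\<forall>u\<in>carrier M. poly_act T [:- k, 1:] u = \<zero>\<^bsub>M\<^esub>" using dichotomy by blast
  then have "\<forall>u\<in>carrier M. T u = smul k u" using act_linear_factor_eq_0 by blast
  then show ?thesis unfolding T_def by blast
qed

end

section \<open>Bases and eigenvectors\<close>

lemma linear_map_comp:
  "linear_map U r V s f \<Longrightarrow> linear_map V s W t g \<Longrightarrow> linear_map U r W t (\<lambda>u. g (f u))"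
  by (auto simp: linear_map_def Pi_def)

context K_space
begin

definition lincomb :: "nat \<Rightarrow> (nat \<Rightarrow> 'v) \<Rightarrow> (nat \<Rightarrow> 'k) \<Rightarrow> 'v" where
  "lincomb n v a = (\<Oplus>i\<in>{..<n}. scale (a i) (v i))"

definition is_basis :: "nat \<Rightarrow> (nat \<Rightarrow> 'v) \<Rightarrow> bool" where
  "is_basis n v \<longleftrightarrow> (\<forall>i<n. v i \<in> carrier V) \<and> (\<forall>u\<in>carrier V. \<exists>a. u = lincomb n v a) \<and>
     (\<forall>a. lincomb n v a = \<zero> \<longrightarrow> (\<forall>i<n. a i = 0))"

lemma lincomb_0 [simp]: "lincomb 0 v a = \<zero>"
  by (simp add: lincomb_def)

lemma lincomb_Suc [simp]:
  "(\<And>i. i < Suc n \<Longrightarrow> v i \<in> carrier V) \<Longrightarrow> lincomb (Suc n) v a = scale (a n) (v n) \<oplus> lincomb n v a"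
  unfolding lincomb_def lessThan_Suc by (subst finsum_insert) auto

lemma lincomb_closed [simp]: "(\<And>i. i < n \<Longrightarrow> v i \<in> carrier V) \<Longrightarrow> lincomb n v a \<in> carrier V"
  by (induction n) auto

lemma lincomb_cong:
  "(\<And>i. i < n \<Longrightarrow> v i \<in> carrier V) \<Longrightarrow> (\<And>i. i < n \<Longrightarrow> scale (a i) (v i) = scale (a' i) (v' i)) \<Longrightarrow>
   (\<And>i. i < n \<Longrightarrow> v' i \<in> carrier V) \<Longrightarrow> lincomb n v a = lincomb n v' a'"
  by (induction n) auto

lemma lincomb_add:
  "(\<And>i. i < n \<Longrightarrow> v i \<in> carrier V) \<Longrightarrow> lincomb n v (\<lambda>i. a i + a' i) = lincomb n v a \<oplus> lincomb n v a'"
  by (induction n) (auto simp: scale_add_left a_ac)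

lemma lincomb_scale:
  "(\<And>i. i < n \<Longrightarrow> v i \<in> carrier V) \<Longrightarrow> lincomb n v (\<lambda>i. k * a i) = scale k (lincomb n v a)"
  by (induction n) (auto simp: scale_add_right scale_scale)

lemma lincomb_single:
  assumes v: "\<And>i. i < n \<Longrightarrow> v i \<in> carrier V" and j: "j < n"
  shows "lincomb n v (\<lambda>i. if i = j then k else 0) = scale k (v j)"
proof -
  have 0: "lincomb m v (\<lambda>i. if i = j then k else 0) = \<zero>" if "m \<le> j" "m \<le> n" for m
    using that v by (induction m) auto
  have "m \<le> n \<Longrightarrow> lincomb m v (\<lambda>i. if i = j then k else 0) = scale k (v j)" if "j < m" for m
    using that
  proof (induction m)
    case (Suc m)
    then show ?case using v 0 by (cases "j = m") auto
  qed simp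
  then show ?thesis using j by blast
qed

lemma lincomb_in_subspace:
  assumes "\<And>i. i < n \<Longrightarrow> v i \<in> carrier V" "\<And>i. i < n \<Longrightarrow> v i \<in> N" "\<zero> \<in> N"
    and "\<And>u w. u \<in> N \<Longrightarrow> w \<in> N \<Longrightarrow> u \<oplus> w \<in> N" "\<And>k u. u \<in> N \<Longrightarrow> scale k u \<in> N"
  shows "lincomb n v a \<in> N"
  using assms(1,2) by (induction n) (auto intro: assms)

lemma linear_map_lincomb:
  assumes "K_space W t" and f: "linear_map V scale W t f"
    and v: "\<And>i. i < n \<Longrightarrow> v i \<in> carrier V"
  shows "f (lincomb n v a) = K_space.lincomb W t n (\<lambda>i. f (v i)) a"
proof -
  interpret W: K_space W t by fact
  show ?thesis
    using v
  proof (induction n)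
    case 0
    show ?case using linear_map_zero[OF f W.abelian_group_axioms] by simp
  next
    case (Suc n)
    then show ?case
      using linear_map_closed[OF f] by (simp add: linear_map_add[OF f] linear_map_scale[OF f])
  qed
qed

lemma basis_closed: "is_basis n v \<Longrightarrow> i < n \<Longrightarrow> v i \<in> carrier V"
  by (auto simp: is_basis_def)

lemma basis_expand:
  assumes "is_basis n v" "u \<in> carrier V"
  obtains a where "u = lincomb n v a"
  using assms by (auto simp: is_basis_def)

lemma basis_independent: "is_basis n v \<Longrightarrow> lincomb n v a = \<zero> \<Longrightarrow> i < n \<Longrightarrow> a i = 0"
  by (auto simp: is_basis_def)

lemma basis_unique:
  assumes v: "is_basis n v" and eq: "lincomb n v a = lincomb n v a'" and i: "i < n"
  shows "a i = a' i"
proof -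
  note c = basis_closed[OF v]
  have "lincomb n v (\<lambda>i. a i + (- 1) * a' i) = \<zero>"
    using c eq by (subst lincomb_add, simp, subst lincomb_scale) (simp_all add: scale_minus r_neg)
  from basis_independent[OF v this i] show ?thesis by simp
qed

lemma basis_nonzero: "is_basis n v \<Longrightarrow> i < n \<Longrightarrow> v i \<noteq> \<zero>"
  using basis_independent[of n v "\<lambda>j. if j = i then 1 else 0" i] lincomb_single[of n v i 1] basis_closed[of n v]
  by auto

lemma linear_maps_eq_if_eq_on_basis:
  assumes v: "is_basis n v" and "K_space W t" and f: "linear_map V scale W t f" and g: "linear_map V scale W t g"
    and eq: "\<And>i. i < n \<Longrightarrow> f (v i) = g (v i)" and u: "u \<in> carrier V"
  shows "f u = g u"
proof -
  interpret W: K_space W t by fact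
  obtain a where a: "u = lincomb n v a" using basis_expand[OF v u] .
  note c = basis_closed[OF v]
  have "f u = W.lincomb n (\<lambda>i. f (v i)) a"
    unfolding a using c by (intro linear_map_lincomb[OF \<open>K_space W t\<close> f])
  also have "\<dots> = W.lincomb n (\<lambda>i. g (v i)) a"
    by (rule W.lincomb_cong) (use eq c linear_map_closed[OF f] linear_map_closed[OF g] in auto)
  also have "\<dots> = g u"
    unfolding a using c by (intro linear_map_lincomb[OF \<open>K_space W t\<close> g, symmetric])
  finally show ?thesis .
qed

lemma linear_map_from_basis:
  assumes v: "is_basis n v" and "K_space W t" and w: "\<And>i. i < n \<Longrightarrow> w i \<in> carrier W"
  obtains f where "linear_map V scale W t f" "\<And>i. i < n \<Longrightarrow> f (v i) = w i"
proof -
  interpret W: K_space W t by fact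
  note c = basis_closed[OF v]
  define f where "f u = W.lincomb n w (SOME a. u = lincomb n v a)" for u
  have f: "f (lincomb n v a) = W.lincomb n w a" for a
  proof -
    define a' where "a' = (SOME a'. lincomb n v a = lincomb n v a')"
    have "lincomb n v a = lincomb n v a'" unfolding a'_def by (rule someI[of _ a]) simp
    then have "a i = a' i" if "i < n" for i using basis_unique[OF v _ that] by blast
    then have "W.lincomb n w a' = W.lincomb n w a" using w by (intro W.lincomb_cong) auto
    then show ?thesis by (simp add: f_def a'_def)
  qed
  have "linear_map V scale W t f"
    unfolding linear_map_def
  proof (intro conjI ballI allI)
    show "f \<in> carrier V \<rightarrow> carrier W" using w by (auto simp: f_def)
    fix u assume "u \<in> carrier V"
    then obtain a where a: "u = lincomb n v a" using basis_expand[OF v] by blast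
    show "f (scale k u) = t k (f u)" for k
      unfolding a using c w by (simp add: f W.lincomb_scale flip: lincomb_scale)
    fix u' assume "u' \<in> carrier V"
    then obtain a' where a': "u' = lincomb n v a'" using basis_expand[OF v] by blast
    show "f (u \<oplus> u') = f u \<oplus>\<^bsub>W\<^esub> f u'"
      unfolding a a' using c w by (simp add: f W.lincomb_add flip: lincomb_add)
  qed
  moreover have "f (v i) = w i" if "i < n" for i
    using f[of "\<lambda>j. if j = i then 1 else 0"] lincomb_single[of n v i 1] W.lincomb_single[of n w i 1] c w that by simp
  ultimately show ?thesis by (rule that)
qed

lemma linear_iso_of_bases:
  assumes v: "is_basis n v" and W: "K_space W t" and w: "K_space.is_basis W t n w"
  obtains f where "linear_map V scale W t f" "bij_betw f (carrier V) (carrier W)" "\<And>i. i < n \<Longrightarrow> f (v i) = w i"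
proof -
  interpret W: K_space W t by fact
  obtain f where f: "linear_map V scale W t f" "\<And>i. i < n \<Longrightarrow> f (v i) = w i"
    using linear_map_from_basis[OF v W, of w] W.basis_closed[OF w] by blast
  obtain g where g: "linear_map W t V scale g" "\<And>i. i < n \<Longrightarrow> g (w i) = v i"
    using W.linear_map_from_basis[OF w K_space_axioms, of v] basis_closed[OF v] by blast
  have id: "linear_map U s U s (\<lambda>u. u)" for U :: "('x, 'y) ring_scheme" and s :: "'z \<Rightarrow> 'x \<Rightarrow> 'x"
    by (simp add: linear_map_def)
  have "g (f u) = u" if "u \<in> carrier V" for u
    using linear_maps_eq_if_eq_on_basis[OF v K_space_axioms linear_map_comp[OF f(1) g(1)] id _ that] f g by simp
  moreover have "f (g u) = u" if "u \<in> carrier W" for u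
    using W.linear_maps_eq_if_eq_on_basis[OF w W linear_map_comp[OF g(1) f(1)] id _ that] f g by simp
  ultimately have "bij_betw f (carrier V) (carrier W)"
    using linear_map_closed[OF f(1)] linear_map_closed[OF g(1)] by (intro bij_betw_byWitness[of _ g]) auto
  then show ?thesis using f that by blast
qed

end

context K_operator
begin

lemma act_lincomb_eigenvectors:
  assumes v: "\<And>i. i < n \<Longrightarrow> v i \<in> carrier V" and c: "\<And>i. i < n \<Longrightarrow> T (v i) = scale (c i) (v i)"
  shows "p \<star> lincomb n v a = lincomb n v (\<lambda>i. a i * poly p (c i))"
proof -
  have "p \<star> lincomb n v a = lincomb n (\<lambda>i. p \<star> v i) a"
    using v by (intro linear_map_lincomb[OF K_space_axioms linear_map_act])
  also have "\<dots> = lincomb n v (\<lambda>i. a i * poly p (c i))"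
    by (rule lincomb_cong) (use v c in \<open>auto simp: act_eigenvector scale_scale\<close>)
  finally show ?thesis .
qed

text \<open>The polynomial vanishing at all eigenvalues except the \<open>i\<close>-th one isolates the \<open>i\<close>-th
  coefficient.\<close>

lemma eigenvectors_independent:
  assumes v: "\<And>i. i < n \<Longrightarrow> v i \<in> carrier V" "\<And>i. i < n \<Longrightarrow> v i \<noteq> \<zero>"
    and c: "\<And>i. i < n \<Longrightarrow> T (v i) = scale (c i) (v i)" and inj: "inj_on c {..<n}"
    and eq: "lincomb n v a = \<zero>" and i: "i < n"
  shows "a i = 0"
proof -
  define p where "p = (\<Prod>j\<in>{..<n} - {i}. [:- c j, 1:])"
  have p: "poly p (c j) = 0 \<longleftrightarrow> j \<noteq> i" if "j < n" for j
    using that inj i by (auto simp: p_def poly_prod inj_on_def)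
  have "\<zero> = p \<star> lincomb n v a" using eq by simp
  also have "\<dots> = lincomb n v (\<lambda>j. a j * poly p (c j))" using v c by (intro act_lincomb_eigenvectors)
  also have "\<dots> = lincomb n v (\<lambda>j. if j = i then a i * poly p (c i) else 0)"
  proof (rule lincomb_cong)
    show "scale (a j * poly p (c j)) (v j) = scale (if j = i then a i * poly p (c i) else 0) (v j)"
      if "j < n" for j
      using p[OF that] by (cases "j = i") simp_all
  qed (use v in auto)
  also have "\<dots> = scale (a i * poly p (c i)) (v i)" using v i by (intro lincomb_single)
  finally have "a i * poly p (c i) = 0" using scale_eq_zero[of "v i"] v i by metis
  then show ?thesis using p[OF i] by simp
qed

lemma eigenvalue_in_eigenbasis:
  assumes v: "is_basis n v" and c: "\<And>i. i < n \<Longrightarrow> T (v i) = scale (c i) (v i)"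
    and u: "u \<in> carrier V" "u \<noteq> \<zero>" and k: "T u = scale k u"
  obtains i where "i < n" "k = c i"
proof -
  note vc = basis_closed[OF v]
  obtain a where a: "u = lincomb n v a" using basis_expand[OF v u(1)] .
  have "\<zero> = [:- k, 1:] \<star> u" using act_linear_factor_eq_0[of u k] u k by (simp del: act_closed)
  also have "\<dots> = lincomb n v (\<lambda>i. a i * poly [:- k, 1:] (c i))"
    unfolding a using vc c by (intro act_lincomb_eigenvectors)
  finally have *: "a i * poly [:- k, 1:] (c i) = 0" if "i < n" for i
    using basis_independent[OF v _ that] by metis
  have "\<exists>i<n. a i \<noteq> 0"
  proof (rule ccontr)
    assume "\<not> ?thesis"
    then have "lincomb n v a = lincomb n v (\<lambda>i. 0 * a i)" by (intro lincomb_cong) (use vc in auto)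
    also have "\<dots> = \<zero>" using vc by (subst lincomb_scale) auto
    finally show False using a u by simp
  qed
  then show ?thesis using * that by fastforce
qed

end

section \<open>Characters whose image is generated by a root of unity\<close>

locale primitive_character = comm_group G
  for G :: "('g, 'm) monoid_scheme" (structure) and \<eta> :: "'g \<Rightarrow> 'k::field" and b :: 'g and n :: nat +
  assumes eta_hom: "\<eta> \<in> hom G Kx" and b [simp]: "b \<in> carrier G"
    and root: "is_primitive_root n (\<eta> b)" and image: "\<eta> ` carrier G = generate Kx {\<eta> b}"
begin

abbreviation N where "N \<equiv> kernel G Kx \<eta>"

lemma n_pos [simp]: "n > 0" and root_power [simp]: "\<eta> b ^ n = 1"
  and root_minimal: "0 < k \<Longrightarrow> k < n \<Longrightarrow> \<eta> b ^ k \<noteq> 1"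
  using root by (auto simp: is_primitive_root_def)

lemma eta_nonzero: "g \<in> carrier G \<Longrightarrow> \<eta> g \<noteq> 0"
  by (rule char_nonzero[OF eta_hom])

lemma eta_pow: "g \<in> carrier G \<Longrightarrow> \<eta> (g [^] (k::nat)) = \<eta> g ^ k"
  by (induction k) (auto simp: char_mult[OF eta_hom] char_one[OF eta_hom is_group])

lemma N_iff: "h \<in> N \<longleftrightarrow> h \<in> carrier G \<and> \<eta> h = 1"
  by (auto simp: kernel_def)

lemma N_closed [simp]: "h \<in> N \<Longrightarrow> h \<in> carrier G"
  by (simp add: N_iff)

lemma b_pow_n: "b [^] n \<in> N"
  by (simp add: N_iff eta_pow)

lemma eta_is_power:
  assumes "g \<in> carrier G"
  obtains k :: nat where "\<eta> g = \<eta> b ^ k"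
proof -
  have b0: "\<eta> b \<noteq> 0" by (simp add: eta_nonzero)
  have "\<eta> g \<in> generate Kx {\<eta> b}" using assms image by blast
  then have "\<exists>k::nat. \<eta> g = \<eta> b ^ k"
  proof induction
    case one
    show ?case by (intro exI[of _ 0]) simp
  next
    case (incl h)
    then show ?case by (intro exI[of _ 1]) simp
  next
    case (inv h)
    have "inv\<^bsub>Kx\<^esub> (\<eta> b) = \<eta> b ^ (n - 1)"
      using b0 power_minus_mult[OF n_pos, of "\<eta> b"] group_Kx[where ?'k='k]
      by (intro group.inv_equality) (auto simp: comm_group_def)
    with inv show ?case by auto
  next
    case (eng h h')
    then show ?case by (auto simp flip: power_add)
  qed
  then show ?thesis using that by blast
qed

lemma root_powers_inj: "inj_on (\<lambda>i. \<eta> b ^ i) {..<n}"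
proof -
  have "\<eta> b ^ i \<noteq> \<eta> b ^ j" if "i < j" "j < n" for i j
  proof
    assume "\<eta> b ^ i = \<eta> b ^ j"
    then have "\<eta> b ^ (j - i) = 1" using power_diff[of "\<eta> b" i j] that eta_nonzero by simp
    then show False using root_minimal[of "j - i"] that by simp
  qed
  then show ?thesis by (metis inj_onI lessThan_iff nat_neq_iff)
qed

lemma eta_power_n:
  assumes "g \<in> carrier G"
  shows "\<eta> g ^ n = 1"
proof -
  obtain k where "\<eta> g = \<eta> b ^ k" using eta_is_power[OF assms] .
  then show ?thesis by (metis mult.commute power_mult power_one root_power)
qed

lemma decompose:
  assumes g: "g \<in> carrier G"
  obtains h k where "h \<in> N" "g = h \<otimes> b [^] (k::nat)"
proof -
  obtain k where k: "\<eta> g = \<eta> b ^ k" using eta_is_power[OF g] .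
  define h where "h = g \<otimes> inv (b [^] k)"
  have hg: "h \<otimes> b [^] k = g" "h \<in> carrier G" using g by (simp_all add: h_def m_assoc)
  then have "\<eta> h * \<eta> b ^ k = \<eta> b ^ k" using k eta_pow char_mult[OF eta_hom, of h "b [^] k"] by simp
  then have "h \<in> N" using hg eta_nonzero by (simp add: N_iff)
  then show ?thesis using hg that by metis
qed

end

section \<open>The modules \<open>V\<^sub>y(\<alpha>,\<lambda>)\<close>\<close>

context skew_module
begin

lemma grp_smul:
  "g \<in> carrier G \<Longrightarrow> u \<in> carrier M \<Longrightarrow> elt_grp g \<odot>\<^bsub>M\<^esub> smul a u = smul a (elt_grp g \<odot>\<^bsub>M\<^esub> u)"
  by (rule smult_smul) simp_all

lemma K_basis_iff_is_basis: "K_basis G M n v \<longleftrightarrow> is_basis n v"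
proof
  assume B: "K_basis G M n v"
  have v: "v i \<in> carrier M" if "i < n" for i using B that by (auto simp: K_basis_def)
  have ex1: "\<exists>!a. a \<in> {..<n} \<rightarrow>\<^sub>E UNIV \<and> u = lincomb n v a" if "u \<in> carrier M" for u
    using B that by (auto simp: K_basis_def lincomb_def)
  have "a i = 0" if a: "lincomb n v a = \<zero>\<^bsub>M\<^esub>" and i: "i < n" for a i
  proof -
    have "lincomb n v (restrict a {..<n}) = \<zero>\<^bsub>M\<^esub>"
      using v by (subst a[symmetric], intro lincomb_cong) auto
    moreover have "lincomb n v (\<lambda>i. 0 * a i) = \<zero>\<^bsub>M\<^esub>"
      using v by (subst lincomb_scale) auto
    then have "lincomb n v (restrict (\<lambda>i. 0) {..<n}) = \<zero>\<^bsub>M\<^esub>"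
      using v lincomb_cong[of n v "restrict (\<lambda>i. 0) {..<n}" "\<lambda>i. 0 * a i" v] by simp
    ultimately have "restrict a {..<n} = restrict (\<lambda>i. 0) {..<n}"
      using ex1[OF H.zero_closed] by (metis restrict_PiE_iff UNIV_I)
    then show ?thesis using i by (metis lessThan_iff restrict_apply')
  qed
  moreover have "\<exists>a. u = lincomb n v a" if "u \<in> carrier M" for u using ex1[OF that] by blast
  ultimately show "is_basis n v" using v by (auto simp: is_basis_def)
next
  assume B: "is_basis n v"
  note v = basis_closed[OF B]
  show "K_basis G M n v"
    unfolding K_basis_def lincomb_def[symmetric]
  proof (intro conjI ballI)
    show "v \<in> {..<n} \<rightarrow> carrier M" using v by auto
    fix u assume "u \<in> carrier M"
    then obtain a where a: "u = lincomb n v a" using basis_expand[OF B] by blast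
    show "\<exists>!a. a \<in> {..<n} \<rightarrow>\<^sub>E UNIV \<and> u = lincomb n v a"
    proof (rule ex1I[of _ "restrict a {..<n}"])
      show "restrict a {..<n} \<in> {..<n} \<rightarrow>\<^sub>E UNIV \<and> u = lincomb n v (restrict a {..<n})"
        unfolding a using v by (auto intro!: lincomb_cong)
      fix a' assume a': "a' \<in> {..<n} \<rightarrow>\<^sub>E UNIV \<and> u = lincomb n v a'"
      then have "a' i = a i" if "i < n" for i using basis_unique[OF B _ that] a by metis
      then show "a' = restrict a {..<n}" using a' by (auto simp: PiE_def extensional_def fun_eq_iff)
    qed
  qed
qed

end

locale skew_module_root = skew_module G \<chi> \<eta> M + C: primitive_character G \<eta> b n
  for G :: "('g, 'm) monoid_scheme" and \<chi> \<eta> :: "'g \<Rightarrow> 'k::field"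
    and M :: "(('g, 'k) skew, 'v, 'd) module_scheme" and b :: 'g and n :: nat
begin

abbreviation N where "N \<equiv> kernel G Kx \<eta>"

text \<open>The basis is \<open>v i = b\<^sup>i w\<close>. These are eigenvectors of \<open>y\<close> for the distinct eigenvalues
  \<open>q\<^sup>i \<alpha>\<close>, hence independent. Since every \<open>g\<close> is \<open>h b\<^sup>k\<close> with \<open>h \<in> ker \<eta>\<close>, and \<open>b\<^sup>n\<close>
  lies in \<open>ker \<eta>\<close>, their span is a submodule. This lemma serves both to recognise a simple
  module and to change the starting vector of a given basis.\<close>

lemma is_V_y_from_eigenvector:
  assumes w: "w \<in> carrier M" "w \<noteq> \<zero>\<^bsub>M\<^esub>" and \<alpha>: "\<alpha> \<noteq> 0"
    and x: "elt_x G \<odot>\<^bsub>M\<^esub> w = \<zero>\<^bsub>M\<^esub>" and y: "elt_y G \<odot>\<^bsub>M\<^esub> w = smul \<alpha> w"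
    and N: "\<And>h. h \<in> N \<Longrightarrow> elt_grp h \<odot>\<^bsub>M\<^esub> w = smul (\<mu> h) w"
    and gen: "\<And>S. submodule S R M \<Longrightarrow> w \<in> S \<Longrightarrow> carrier M \<subseteq> S"
  shows "is_V_y G \<chi> \<eta> b n \<alpha> \<mu> M"
proof -
  define v where "v i = elt_grp (b [^]\<^bsub>G\<^esub> i) \<odot>\<^bsub>M\<^esub> w" for i :: nat
  have vc: "v i \<in> carrier M" for i using w by (simp add: v_def)
  have v0: "v 0 = w" using grp_one[OF w(1)] by (simp add: v_def)
  have v_nonzero: "v i \<noteq> \<zero>\<^bsub>M\<^esub>" for i using grp_inj[of "b [^]\<^bsub>G\<^esub> i" w] w by (auto simp: v_def)
  have xv: "elt_x G \<odot>\<^bsub>M\<^esub> v i = \<zero>\<^bsub>M\<^esub>" for i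
    using w x by (simp add: v_def x_grp)
  have yv: "elt_y G \<odot>\<^bsub>M\<^esub> v i = smul (\<eta> b ^ i * \<alpha>) (v i)" for i
    using w y by (simp add: v_def y_grp grp_smul scale_scale C.eta_pow)
  have bv: "elt_grp (b [^]\<^bsub>G\<^esub> j) \<odot>\<^bsub>M\<^esub> v i = v (j + i)" for i j
    using w by (simp add: v_def grp_grp G.nat_pow_mult)
  have hv: "elt_grp h \<odot>\<^bsub>M\<^esub> v i = smul (\<mu> h) (v i)" if h: "h \<in> N" for h i
  proof -
    have "elt_grp h \<odot>\<^bsub>M\<^esub> v i = elt_grp (b [^]\<^bsub>G\<^esub> i) \<odot>\<^bsub>M\<^esub> (elt_grp h \<odot>\<^bsub>M\<^esub> w)"
      using w h by (simp add: v_def grp_grp G.m_comm)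
    then show ?thesis using w N[OF h] by (simp add: v_def grp_smul)
  qed
  have vn: "v (n + i) = smul (\<mu> (b [^]\<^bsub>G\<^esub> n)) (v i)" for i
    using hv[OF C.b_pow_n] bv[of n] by simp
  interpret K_operator M smul "\<lambda>u. elt_y G \<odot>\<^bsub>M\<^esub> u"
    by unfold_locales (simp add: linear_map_smult)
  have "inj_on (\<lambda>i. \<eta> b ^ i * \<alpha>) {..<n}" using C.root_powers_inj \<alpha> by (simp add: inj_on_def)
  then have indep: "a i = 0" if "lincomb n v a = \<zero>\<^bsub>M\<^esub>" "i < n" for a i
    using eigenvectors_independent[of n v "\<lambda>i. \<eta> b ^ i * \<alpha>" a i] vc v_nonzero yv that by blast
  define S where "S = range (lincomb n v)"
  have Sc: "S \<subseteq> carrier M" using vc by (auto simp: S_def)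
  have S_add: "u \<oplus>\<^bsub>M\<^esub> u' \<in> S" if "u \<in> S" "u' \<in> S" for u u'
    using that vc by (auto simp: S_def simp flip: lincomb_add)
  have S_scale: "smul k u \<in> S" if "u \<in> S" for k u
    using that vc by (auto simp: S_def simp flip: lincomb_scale)
  have vS_less: "v i \<in> S" if "i < n" for i
    using lincomb_single[of n v i 1] vc that unfolding S_def by (metis rangeI scale_one)
  \<comment> \<open>Indices from \<open>n\<close> on are reduced by means of \<open>b\<^sup>n \<in> ker \<eta>\<close>.\<close>
  have vS: "v i \<in> S" for i
  proof (induction i rule: less_induct)
    case (less i)
    show ?case
    proof (cases "i < n")
      case False
      then have "v i = smul (\<mu> (b [^]\<^bsub>G\<^esub> n)) (v (i - n))" using vn[of "i - n"] by simp
      then show ?thesis using False less[of "i - n"] S_scale C.n_pos by simp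
    qed (rule vS_less)
  qed
  have S0: "\<zero>\<^bsub>M\<^esub> \<in> S" using S_scale[OF vS[of 0], of 0] vc by simp
  have S_linear: "f u \<in> S" if "linear_map M smul M smul f" "\<And>i. i < n \<Longrightarrow> f (v i) \<in> S" "u \<in> S" for f u
  proof -
    obtain a where "u = lincomb n v a" using \<open>u \<in> S\<close> by (auto simp: S_def)
    then have "f u = lincomb n (\<lambda>i. f (v i)) a"
      using linear_map_lincomb[OF K_space_axioms that(1)] vc by simp
    also have "\<dots> \<in> S" using that Sc S0 S_add S_scale by (intro lincomb_in_subspace) auto
    finally show ?thesis .
  qed
  have "\<forall>u\<in>S. r \<odot>\<^bsub>M\<^esub> u \<in> S" if "r \<in> carrier R" for r
    using that
  proof (induction rule: skew_ring_induct)
    case (add r s)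
    then show ?case using Sc S_add by (auto simp: smult_add subset_iff)
  next
    case (mult r s)
    then show ?case using Sc by (auto simp: smult_mult subset_iff)
  next
    case (scalar a)
    then show ?case using S_scale by simp
  next
    case x
    show ?case using S_linear[OF linear_map_smult[of "elt_x G"]] xv S0 by simp
  next
    case y
    show ?case using S_linear[OF linear_map_smult[of "elt_y G"]] yv S_scale vS by simp
  next
    case (grp g)
    then obtain h k where hk: "h \<in> N" "g = h \<otimes>\<^bsub>G\<^esub> b [^]\<^bsub>G\<^esub> (k::nat)" by (rule C.decompose)
    have "elt_grp g \<odot>\<^bsub>M\<^esub> v i = smul (\<mu> h) (v (k + i))" for i
      using hk vc hv bv[of k i] grp_grp[of h "b [^]\<^bsub>G\<^esub> k" "v i"] by simp
    then show ?case using S_linear[OF linear_map_smult[of "elt_grp g"]] S_scale vS grp by simp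
  qed
  then have "submodule S R M" using Sc S0 S_add by (intro submoduleI) auto
  then have span: "carrier M \<subseteq> S" using gen vS[of 0] v0 by simp
  have basis: "is_basis n v"
    unfolding is_basis_def using vc indep span by (auto simp: S_def)
  have "elt_grp b \<odot>\<^bsub>M\<^esub> v i = (if i = n - 1 then smul (\<mu> (b [^]\<^bsub>G\<^esub> n)) (v 0) else v (i + 1))" for i
    using bv[of 1 i] vn[of 0] C.n_pos by (cases "i = n - 1") auto
  then show ?thesis
    unfolding is_V_y_def using basis xv yv hv H.left_module_axioms
    by (auto simp: K_basis_iff_is_basis)
qed

lemma is_V_yE:
  assumes "is_V_y G \<chi> \<eta> b n \<alpha> \<mu> M"
  obtains v where "is_basis n v"
    "\<And>i. i < n \<Longrightarrow> elt_x G \<odot>\<^bsub>M\<^esub> v i = \<zero>\<^bsub>M\<^esub>"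
    "\<And>i. i < n \<Longrightarrow> elt_y G \<odot>\<^bsub>M\<^esub> v i = smul (\<eta> b ^ i * \<alpha>) (v i)"
    "\<And>h i. h \<in> N \<Longrightarrow> i < n \<Longrightarrow> elt_grp h \<odot>\<^bsub>M\<^esub> v i = smul (\<mu> h) (v i)"
    "\<And>i. i < n \<Longrightarrow> elt_grp b \<odot>\<^bsub>M\<^esub> v i = (if i = n - 1 then smul (\<mu> (b [^]\<^bsub>G\<^esub> n)) (v 0) else v (i + 1))"
    "\<And>i. i < n \<Longrightarrow> v i = elt_grp (b [^]\<^bsub>G\<^esub> i) \<odot>\<^bsub>M\<^esub> v 0"
proof -
  obtain v where v: "is_basis n v"
    and x: "\<And>i. i < n \<Longrightarrow> elt_x G \<odot>\<^bsub>M\<^esub> v i = \<zero>\<^bsub>M\<^esub>"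
    and y: "\<And>i. i < n \<Longrightarrow> elt_y G \<odot>\<^bsub>M\<^esub> v i = smul (\<eta> b ^ i * \<alpha>) (v i)"
    and h: "\<And>h i. h \<in> N \<Longrightarrow> i < n \<Longrightarrow> elt_grp h \<odot>\<^bsub>M\<^esub> v i = smul (\<mu> h) (v i)"
    and b: "\<And>i. i < n \<Longrightarrow> elt_grp b \<odot>\<^bsub>M\<^esub> v i = (if i = n - 1 then smul (\<mu> (b [^]\<^bsub>G\<^esub> n)) (v 0) else v (i + 1))"
    using assms unfolding is_V_y_def K_basis_iff_is_basis by blast
  have v0: "v 0 \<in> carrier M" using basis_closed[OF v] by simp
  have "v i = elt_grp (b [^]\<^bsub>G\<^esub> i) \<odot>\<^bsub>M\<^esub> v 0" if "i < n" for i
    using that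
  proof (induction i)
    case 0
    show ?case using grp_one[OF v0] by simp
  next
    case (Suc i)
    then have "i < n" "i \<noteq> n - 1" by auto
    then have "v (Suc i) = elt_grp b \<odot>\<^bsub>M\<^esub> v i" using b[of i] by simp
    also have "v i = elt_grp (b [^]\<^bsub>G\<^esub> i) \<odot>\<^bsub>M\<^esub> v 0" using Suc by simp
    finally show ?case using v0 by (simp add: grp_grp G.m_comm)
  qed
  then show ?thesis using that v x y h b by blast
qed

text \<open>Starting from \<open>v j\<close> instead of \<open>v 0\<close> replaces \<open>\<alpha>'\<close> by \<open>q\<^sup>j \<alpha>'\<close>. The vector \<open>v j\<close>
  generates the module as well, because \<open>b\<close> is invertible. As \<open>q\<^sup>n = 1\<close>, the index \<open>j\<close> only
  matters modulo \<open>n\<close>.\<close>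

lemma is_V_y_shift:
  assumes V: "is_V_y G \<chi> \<eta> b n \<alpha>' \<mu>' M" and \<alpha>': "\<alpha>' \<noteq> 0"
    and \<alpha>: "\<alpha> = \<eta> b ^ j * \<alpha>'" and \<mu>: "\<And>h. h \<in> N \<Longrightarrow> \<mu> h = \<mu>' h"
  shows "is_V_y G \<chi> \<eta> b n \<alpha> \<mu> M"
proof -
  from is_V_yE[OF V] obtain v where v: "is_basis n v"
    and x: "\<And>i. i < n \<Longrightarrow> elt_x G \<odot>\<^bsub>M\<^esub> v i = \<zero>\<^bsub>M\<^esub>"
    and y: "\<And>i. i < n \<Longrightarrow> elt_y G \<odot>\<^bsub>M\<^esub> v i = smul (\<eta> b ^ i * \<alpha>') (v i)"
    and h: "\<And>h i. h \<in> N \<Longrightarrow> i < n \<Longrightarrow> elt_grp h \<odot>\<^bsub>M\<^esub> v i = smul (\<mu>' h) (v i)"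
    and b0: "\<And>i. i < n \<Longrightarrow> v i = elt_grp (b [^]\<^bsub>G\<^esub> i) \<odot>\<^bsub>M\<^esub> v 0"
    by metis
  note vc = basis_closed[OF v]
  define i where "i = j mod n"
  have i: "i < n" by (simp add: i_def)
  have "\<eta> b ^ j = \<eta> b ^ (n * (j div n) + i)" by (simp add: i_def)
  also have "\<dots> = \<eta> b ^ i" by (simp only: power_add power_mult C.root_power power_one mult_1)
  finally have "\<alpha> = \<eta> b ^ i * \<alpha>'" using \<alpha> by simp
  moreover have "carrier M \<subseteq> S" if S: "submodule S R M" "v i \<in> S" for S
  proof -
    interpret S: submodule S R M by fact
    have "elt_grp (inv\<^bsub>G\<^esub> (b [^]\<^bsub>G\<^esub> i)) \<odot>\<^bsub>M\<^esub> v i = v 0"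
      using b0[OF i] vc[of 0] by (simp add: grp_grp grp_one)
    moreover have "elt_grp (inv\<^bsub>G\<^esub> (b [^]\<^bsub>G\<^esub> i)) \<odot>\<^bsub>M\<^esub> v i \<in> S" using S(2) by (intro S.smult_closed) auto
    ultimately have "v 0 \<in> S" by simp
    then have "v k \<in> S" if "k < n" for k
      using b0[OF that] S.smult_closed[of "elt_grp (b [^]\<^bsub>G\<^esub> k)" "v 0"] by simp
    then have "lincomb n v a \<in> S" for a
      using vc S.m_closed S.one_closed by (intro lincomb_in_subspace) auto
    then show ?thesis using basis_expand[OF v] by blast
  qed
  ultimately show ?thesis
    using vc[OF i] basis_nonzero[OF v i] \<alpha>' x[OF i] y[OF i] h[OF _ i] \<mu> C.eta_nonzero
    by (intro is_V_y_from_eigenvector[of "v i"]) auto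
qed

end

section \<open>Isomorphisms and the classification\<close>

text \<open>All generators act on the two bases by the same formulas, so the linear bijection matching
  the bases commutes with the whole ring.\<close>

lemma isomorphic_if_V_y:
  assumes "skew_module_root G \<chi> \<eta> M b n" "skew_module_root G \<chi> \<eta> M' b n"
    and VM: "is_V_y G \<chi> \<eta> b n \<alpha> \<mu> M" and VM': "is_V_y G \<chi> \<eta> b n \<alpha> \<mu> M'"
  shows "left_modules_isomorphic (skew_ring G \<chi> \<eta>) M M'"
proof -
  interpret A: skew_module_root G \<chi> \<eta> M b n by fact
  interpret B: skew_module_root G \<chi> \<eta> M' b n by fact
  from A.is_V_yE[OF VM] obtain v where v: "A.is_basis n v"
    and vx: "\<And>i. i < n \<Longrightarrow> elt_x G \<odot>\<^bsub>M\<^esub> v i = \<zero>\<^bsub>M\<^esub>"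
    and vy: "\<And>i. i < n \<Longrightarrow> elt_y G \<odot>\<^bsub>M\<^esub> v i = A.smul (\<eta> b ^ i * \<alpha>) (v i)"
    and vh: "\<And>h i. h \<in> A.N \<Longrightarrow> i < n \<Longrightarrow> elt_grp h \<odot>\<^bsub>M\<^esub> v i = A.smul (\<mu> h) (v i)"
    and vb: "\<And>i. i < n \<Longrightarrow> elt_grp b \<odot>\<^bsub>M\<^esub> v i = (if i = n - 1 then A.smul (\<mu> (b [^]\<^bsub>G\<^esub> n)) (v 0) else v (i + 1))"
    by metis
  from B.is_V_yE[OF VM'] obtain w where w: "B.is_basis n w"
    and wx: "\<And>i. i < n \<Longrightarrow> elt_x G \<odot>\<^bsub>M'\<^esub> w i = \<zero>\<^bsub>M'\<^esub>"
    and wy: "\<And>i. i < n \<Longrightarrow> elt_y G \<odot>\<^bsub>M'\<^esub> w i = B.smul (\<eta> b ^ i * \<alpha>) (w i)"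
    and wh: "\<And>h i. h \<in> A.N \<Longrightarrow> i < n \<Longrightarrow> elt_grp h \<odot>\<^bsub>M'\<^esub> w i = B.smul (\<mu> h) (w i)"
    and wb: "\<And>i. i < n \<Longrightarrow> elt_grp b \<odot>\<^bsub>M'\<^esub> w i = (if i = n - 1 then B.smul (\<mu> (b [^]\<^bsub>G\<^esub> n)) (w 0) else w (i + 1))"
    by metis
  obtain f where f: "linear_map M A.smul M' B.smul f" and bij: "bij_betw f (carrier M) (carrier M')"
    and fv: "\<And>i. i < n \<Longrightarrow> f (v i) = w i"
    using A.linear_iso_of_bases[OF v B.K_space_axioms w] by blast
  note vc = A.basis_closed[OF v]
  note fc [simp] = linear_map_closed[OF f]
  have fs: "f (A.smul k u) = B.smul k (f u)" if "u \<in> carrier M" for k u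
    using linear_map_scale[OF f that] .
  have f0: "f \<zero>\<^bsub>M\<^esub> = \<zero>\<^bsub>M'\<^esub>" by (rule A.linear_map_zero[OF f B.abelian_M])
  have on_basis: "\<forall>u\<in>carrier M. f (r \<odot>\<^bsub>M\<^esub> u) = r \<odot>\<^bsub>M'\<^esub> f u"
    if r: "r \<in> carrier A.R" and eq: "\<And>i. i < n \<Longrightarrow> f (r \<odot>\<^bsub>M\<^esub> v i) = r \<odot>\<^bsub>M'\<^esub> w i" for r
  proof
    fix u assume u: "u \<in> carrier M"
    show "f (r \<odot>\<^bsub>M\<^esub> u) = r \<odot>\<^bsub>M'\<^esub> f u"
      using A.linear_maps_eq_if_eq_on_basis[OF v B.K_space_axioms
          linear_map_comp[OF A.linear_map_smult[OF r] f] linear_map_comp[OF f B.linear_map_smult[OF r]] _ u]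
        eq fv by simp
  qed
  have fN: "\<forall>u\<in>carrier M. f (elt_grp h \<odot>\<^bsub>M\<^esub> u) = elt_grp h \<odot>\<^bsub>M'\<^esub> f u" if h: "h \<in> A.N" for h
    using h vc by (intro on_basis) (simp_all add: vh wh fs fv)
  have "i + 1 < n" if "i < n" "i \<noteq> n - 1" for i using that by simp
  then have fb: "\<forall>u\<in>carrier M. f (elt_grp b \<odot>\<^bsub>M\<^esub> u) = elt_grp b \<odot>\<^bsub>M'\<^esub> f u"
    using vc A.C.n_pos by (intro on_basis) (auto simp: vb wb fs fv)
  have fbk: "\<forall>u\<in>carrier M. f (elt_grp (b [^]\<^bsub>G\<^esub> k) \<odot>\<^bsub>M\<^esub> u) = elt_grp (b [^]\<^bsub>G\<^esub> k) \<odot>\<^bsub>M'\<^esub> f u" for k :: nat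
    by (induction k) (use fb in \<open>auto simp: A.grp_one B.grp_one simp flip: A.grp_grp B.grp_grp\<close>)
  have "\<forall>u\<in>carrier M. f (r \<odot>\<^bsub>M\<^esub> u) = r \<odot>\<^bsub>M'\<^esub> f u" if "r \<in> carrier A.R" for r
    using that
  proof (induction rule: A.skew_ring_induct)
    case (add r s)
    then show ?case by (simp add: A.smult_add B.smult_add linear_map_add[OF f])
  next
    case (mult r s)
    then show ?case by (simp add: A.smult_mult B.smult_mult)
  next
    case (scalar a)
    show ?case by (simp add: fs)
  next
    case x
    show ?case by (intro on_basis) (simp_all add: vx wx f0)
  next
    case y
    show ?case using vc by (intro on_basis) (simp_all add: vy wy fs fv)
  next
    case (grp g)
    then obtain h k where hk: "h \<in> A.N" "g = h \<otimes>\<^bsub>G\<^esub> b [^]\<^bsub>G\<^esub> (k::nat)" by (rule A.C.decompose)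
    then show ?case using fN[OF hk(1)] fbk[of k] by (simp flip: A.grp_grp B.grp_grp)
  qed
  moreover have "f \<in> iso (add_monoid M) (add_monoid M')"
    using bij by (auto simp: iso_def hom_def linear_map_add[OF f])
  ultimately show ?thesis unfolding left_modules_isomorphic_def by blast
qed

text \<open>The image \<open>u\<close> of the first basis vector of \<open>M\<close> is an eigenvector in \<open>M'\<close>, of \<open>y\<close> with
  eigenvalue \<open>\<alpha>\<close> and of \<open>h \<in> ker \<eta>\<close> with eigenvalue \<open>\<mu> h\<close>. But the basis of \<open>M'\<close> consists
  of eigenvectors as well, and shows that the only eigenvalues of \<open>y\<close> are the \<open>q\<^sup>i \<alpha>'\<close>, and that
  \<open>\<mu>' h\<close> is the only one of \<open>h\<close>.\<close>

lemma V_y_parameters_if_isomorphic: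
  assumes "skew_module_root G \<chi> \<eta> M b n" "skew_module_root G \<chi> \<eta> M' b n"
    and VM: "is_V_y G \<chi> \<eta> b n \<alpha> \<mu> M" and VM': "is_V_y G \<chi> \<eta> b n \<alpha>' \<mu>' M'"
    and iso: "left_modules_isomorphic (skew_ring G \<chi> \<eta>) M M'"
  shows "(\<forall>h\<in>kernel G Kx \<eta>. \<mu> h = \<mu>' h) \<and> (\<exists>i::nat. \<alpha> = \<eta> b ^ i * \<alpha>')"
proof -
  interpret A: skew_module_root G \<chi> \<eta> M b n by fact
  interpret B: skew_module_root G \<chi> \<eta> M' b n by fact
  from A.is_V_yE[OF VM] obtain v where v: "A.is_basis n v"
    and vy: "\<And>i. i < n \<Longrightarrow> elt_y G \<odot>\<^bsub>M\<^esub> v i = A.smul (\<eta> b ^ i * \<alpha>) (v i)"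
    and vh: "\<And>h i. h \<in> A.N \<Longrightarrow> i < n \<Longrightarrow> elt_grp h \<odot>\<^bsub>M\<^esub> v i = A.smul (\<mu> h) (v i)"
    by metis
  from B.is_V_yE[OF VM'] obtain w where w: "B.is_basis n w"
    and wy: "\<And>i. i < n \<Longrightarrow> elt_y G \<odot>\<^bsub>M'\<^esub> w i = B.smul (\<eta> b ^ i * \<alpha>') (w i)"
    and wh: "\<And>h i. h \<in> A.N \<Longrightarrow> i < n \<Longrightarrow> elt_grp h \<odot>\<^bsub>M'\<^esub> w i = B.smul (\<mu>' h) (w i)"
    by metis
  obtain f where f: "f \<in> iso (add_monoid M) (add_monoid M')"
    and fr: "\<And>r u. r \<in> carrier A.R \<Longrightarrow> u \<in> carrier M \<Longrightarrow> f (r \<odot>\<^bsub>M\<^esub> u) = r \<odot>\<^bsub>M'\<^esub> f u"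
    using iso unfolding left_modules_isomorphic_def by blast
  have lin: "linear_map M A.smul M' B.smul f"
    using f fr by (auto simp: linear_map_def iso_def hom_def)
  define u where "u = f (v 0)"
  have v0: "v 0 \<in> carrier M" "v 0 \<noteq> \<zero>\<^bsub>M\<^esub>"
    using A.basis_closed[OF v A.C.n_pos] A.basis_nonzero[OF v A.C.n_pos] .
  have u: "u \<in> carrier M'" using linear_map_closed[OF lin v0(1)] by (simp add: u_def)
  have "f (v 0) \<noteq> f \<zero>\<^bsub>M\<^esub>"
    using f v0 by (auto simp: iso_def bij_betw_def dest: inj_onD)
  then have u0: "u \<noteq> \<zero>\<^bsub>M'\<^esub>" using A.linear_map_zero[OF lin B.abelian_M] by (simp add: u_def)
  interpret Y: K_operator M' B.smul "\<lambda>u. elt_y G \<odot>\<^bsub>M'\<^esub> u"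
    by unfold_locales (simp add: B.linear_map_smult)
  have "elt_y G \<odot>\<^bsub>M'\<^esub> u = B.smul \<alpha> u"
    using vy[OF A.C.n_pos] fr[of "elt_y G" "v 0"] v0 by (simp add: u_def fr)
  from Y.eigenvalue_in_eigenbasis[OF w wy u u0 this] obtain i where "\<alpha> = \<eta> b ^ i * \<alpha>'" .
  moreover have "\<mu> h = \<mu>' h" if h: "h \<in> A.N" for h
  proof -
    have hu: "elt_grp h \<odot>\<^bsub>M'\<^esub> u = B.smul (\<mu> h) u"
      using vh[OF h A.C.n_pos] fr[of "elt_grp h" "v 0"] v0 h by (simp add: u_def fr)
    interpret h: K_operator M' B.smul "\<lambda>u. elt_grp h \<odot>\<^bsub>M'\<^esub> u"
      using h by unfold_locales (simp add: B.linear_map_smult)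
    show ?thesis
      using h.eigenvalue_in_eigenbasis[OF w wh[OF h] u u0 hu] by blast
  qed
  ultimately show ?thesis by blast
qed

text \<open>Otherwise the nonzero polynomial \<open>X\<^sup>n - k\<close> in \<open>y\<close> would act injectively, while it acts by
  zero.\<close>

lemma (in skew_module_closed) y_power_scalar_imp_eigenvector:
  assumes n: "n > 0" and nonzero: "carrier M \<noteq> {\<zero>\<^bsub>M\<^esub>}"
    and yn: "\<And>u. u \<in> carrier M \<Longrightarrow> Poly_Mapping.single (0, n, \<one>\<^bsub>G\<^esub>) 1 \<odot>\<^bsub>M\<^esub> u = smul k u"
  obtains w \<alpha> where "w \<in> carrier M" "w \<noteq> \<zero>\<^bsub>M\<^esub>" "elt_y G \<odot>\<^bsub>M\<^esub> w = smul \<alpha> w"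
proof -
  interpret K_operator_closed M smul "\<lambda>u. elt_y G \<odot>\<^bsub>M\<^esub> u"
    by unfold_locales (simp add: linear_map_smult)
  let ?act = "poly_act (\<lambda>u. elt_y G \<odot>\<^bsub>M\<^esub> u)"
  obtain u where u: "u \<in> carrier M" "u \<noteq> \<zero>\<^bsub>M\<^esub>" using nonzero H.zero_closed by blast
  have monom: "?act (monom 1 i) u = Poly_Mapping.single (0, i, \<one>\<^bsub>G\<^esub>) 1 \<odot>\<^bsub>M\<^esub> u" for i
  proof (induction i)
    case 0
    have "?act (monom 1 0) u = u" using u by (simp add: monom_0)
    also have "\<dots> = Poly_Mapping.single (0, 0, \<one>\<^bsub>G\<^esub>) 1 \<odot>\<^bsub>M\<^esub> u"
      using scale_one[OF u(1)] unfolding elt_scalar_def by (rule sym)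
    finally show ?case .
  next
    case (Suc i)
    have "?act (monom 1 (Suc i)) u = elt_y G \<odot>\<^bsub>M\<^esub> ?act (monom 1 i) u"
      using u by (simp add: monom_Suc act_pCons)
    also have "\<dots> = Poly_Mapping.single (0, Suc i, \<one>\<^bsub>G\<^esub>) 1 \<odot>\<^bsub>M\<^esub> u"
      unfolding Suc.IH using u by (simp add: elt_y_def single_single_smult)
    finally show ?case .
  qed
  define p where "p = monom 1 n + [:- k:]"
  have "coeff p n \<noteq> 0" using n by (cases n) (simp_all add: p_def)
  then have "p \<noteq> 0" by auto
  moreover have "?act p u = \<zero>\<^bsub>M\<^esub>"
    using u by (simp add: p_def act_add_left monom yn flip: scale_add_left)
  ultimately have "\<exists>w \<alpha>. w \<in> carrier M \<and> w \<noteq> \<zero>\<^bsub>M\<^esub> \<and> elt_y G \<odot>\<^bsub>M\<^esub> w = smul \<alpha> w"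
    using torsion_free_if_no_eigenvector[of p u] u by blast
  then show ?thesis using that by blast
qed

text \<open>Both \<open>y\<^sup>n\<close> and the elements of \<open>ker \<eta>\<close> are central modulo \<open>x\<close>. So \<open>ker \<eta>\<close> acts through a
  character \<open>\<mu>\<close>, and \<open>y\<close> has an eigenvector, whose eigenvalue is nonzero because there is no
  \<open>y\<close>-torsion.\<close>

lemma simple_module_is_V_y:
  fixes \<chi> \<eta> :: "'g \<Rightarrow> 'k::{alg_closed_field, field_char_0}"
  assumes "skew_module_root G \<chi> \<eta> V b n" and fg: "finitely_generated_group G"
    and simple: "simple_left_module (skew_ring G \<chi> \<eta>) V"
    and ytf: "torsion_free_wrt (skew_ring G \<chi> \<eta>) (elt_y G) V"
    and xt: "torsion_wrt (skew_ring G \<chi> \<eta>) (elt_x G) V"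
  obtains \<alpha> \<mu> where "\<alpha> \<noteq> 0" "\<mu> \<in> hom (G\<lparr>carrier := kernel G Kx \<eta>\<rparr>) Kx" "is_V_y G \<chi> \<eta> b n \<alpha> \<mu> V"
proof -
  interpret skew_module_root G \<chi> \<eta> V b n by fact
  interpret skew_module_closed G \<chi> \<eta> V by unfold_locales
  have x: "elt_x G \<odot>\<^bsub>V\<^esub> u = \<zero>\<^bsub>V\<^esub>" if "u \<in> carrier V" for u
    by (rule x_eq_zero_if_torsion[OF simple xt that])
  note central = central_monomial_acts_by_scalar[OF fg simple x]
  have "\<exists>k. \<forall>u\<in>carrier V. elt_grp h \<odot>\<^bsub>V\<^esub> u = smul k u" if "h \<in> N" for h
    using central[of h 0] that by (simp add: elt_grp_def C.N_iff)
  then obtain \<mu> where \<mu>: "\<And>h u. h \<in> N \<Longrightarrow> u \<in> carrier V \<Longrightarrow> elt_grp h \<odot>\<^bsub>V\<^esub> u = smul (\<mu> h) u"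
    by metis
  obtain k where k: "\<And>u. u \<in> carrier V \<Longrightarrow> Poly_Mapping.single (0, n, \<one>\<^bsub>G\<^esub>) 1 \<odot>\<^bsub>V\<^esub> u = smul k u"
    using central[of "\<one>\<^bsub>G\<^esub>" n] C.eta_power_n by auto
  have nonzero: "carrier V \<noteq> {\<zero>\<^bsub>V\<^esub>}" using simple by (simp add: simple_left_module_def)
  obtain w \<alpha> where w: "w \<in> carrier V" "w \<noteq> \<zero>\<^bsub>V\<^esub>" "elt_y G \<odot>\<^bsub>V\<^esub> w = smul \<alpha> w"
    using y_power_scalar_imp_eigenvector[OF C.n_pos nonzero k] by blast
  have \<alpha>: "\<alpha> \<noteq> 0"
  proof
    assume "\<alpha> = 0"
    then have "elt_y G [^]\<^bsub>R\<^esub> (1::nat) \<odot>\<^bsub>V\<^esub> w = \<zero>\<^bsub>V\<^esub>" using w H.nat_pow_eone[of "elt_y G"] by simp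
    then show False using ytf w unfolding torsion_free_wrt_def by blast
  qed
  have cancel: "a = a'" if "smul a w = smul a' w" for a a'
    using scale_cancel w that by blast
  have "\<mu> \<in> hom (G\<lparr>carrier := N\<rparr>) Kx"
  proof (rule homI)
    fix h assume "h \<in> carrier (G\<lparr>carrier := N\<rparr>)"
    then have h: "h \<in> N" by simp
    have "\<mu> h \<noteq> 0" using \<mu>[OF h w(1)] grp_inj[of h w] h w by auto
    then show "\<mu> h \<in> carrier Kx" by simp
    fix h' assume "h' \<in> carrier (G\<lparr>carrier := N\<rparr>)"
    then have h': "h' \<in> N" by simp
    have hh': "h \<otimes>\<^bsub>G\<^esub> h' \<in> N" using h h' by (simp add: C.N_iff char_mult[OF eta])
    have "smul (\<mu> (h \<otimes>\<^bsub>G\<^esub> h')) w = elt_grp h \<odot>\<^bsub>V\<^esub> (elt_grp h' \<odot>\<^bsub>V\<^esub> w)"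
      using \<mu>[OF hh' w(1)] h h' w by (simp add: grp_grp)
    also have "\<dots> = smul (\<mu> h * \<mu> h') w" using h h' w by (simp add: \<mu> scale_scale)
    finally show "\<mu> (h \<otimes>\<^bsub>G\<lparr>carrier := N\<rparr>\<^esub> h') = \<mu> h \<otimes>\<^bsub>Kx\<^esub> \<mu> h'" using cancel by simp
  qed
  moreover have "is_V_y G \<chi> \<eta> b n \<alpha> \<mu> V"
    by (rule is_V_y_from_eigenvector[OF w(1,2) \<alpha> x[OF w(1)] w(3)])
      (use \<mu> w simple_carrier_if_nonzero[OF simple] in auto)
  ultimately show ?thesis using that \<alpha> by blast
qed

theorem corollary5p6:
  fixes G :: "('g, 'm) monoid_scheme"
    and \<chi> \<eta> :: "'g \<Rightarrow> 'k::{alg_closed_field, field_char_0}"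
    and b c :: 'g and q :: 'k and n :: nat
  assumes "comm_group G" and "finitely_generated_group G"
    and "b \<in> carrier G" and "c \<in> carrier G"
    and "\<chi> \<in> hom G Kx" and "finite_order_char G \<chi>"
    and "\<eta> \<in> hom G Kx" and "finite_order_char G \<eta>"
    and "\<eta> b = inverse (\<chi> c)"
    and "q = \<eta> b" and "is_primitive_root n q"
    and "\<eta> ` carrier G = generate Kx {q}"
  shows
    "(\<forall>V :: (('g, 'k) skew, 'v, 'd) module_scheme.
        simple_left_module (skew_ring G \<chi> \<eta>) V \<longrightarrow>
        torsion_free_wrt (skew_ring G \<chi> \<eta>) (elt_y G) V \<longrightarrow>
        torsion_wrt (skew_ring G \<chi> \<eta>) (elt_x G) V \<longrightarrow>
        (\<exists>\<alpha> \<mu>. \<alpha> \<noteq> 0 \<and> \<mu> \<in> hom (G\<lparr>carrier := kernel G Kx \<eta>\<rparr>) Kx \<and>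
           is_V_y G \<chi> \<eta> b n \<alpha> \<mu> V)) \<and>
     (\<forall>\<alpha> \<alpha>' \<mu> \<mu>'.
        \<forall>(M :: (('g, 'k) skew, 'w, 'e) module_scheme) (M' :: (('g, 'k) skew, 'w', 'e') module_scheme).
        \<alpha> \<noteq> 0 \<longrightarrow> \<alpha>' \<noteq> 0 \<longrightarrow>
        \<mu> \<in> hom (G\<lparr>carrier := kernel G Kx \<eta>\<rparr>) Kx \<longrightarrow>
        \<mu>' \<in> hom (G\<lparr>carrier := kernel G Kx \<eta>\<rparr>) Kx \<longrightarrow>
        is_V_y G \<chi> \<eta> b n \<alpha> \<mu> M \<longrightarrow> is_V_y G \<chi> \<eta> b n \<alpha>' \<mu>' M' \<longrightarrow>
        (left_modules_isomorphic (skew_ring G \<chi> \<eta>) M M' \<longleftrightarrow>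
           (\<forall>h\<in>kernel G Kx \<eta>. \<mu> h = \<mu>' h) \<and> (\<exists>i::nat. \<alpha> = q ^ i * \<alpha>')))"
proof -
  have root: "skew_module_root G \<chi> \<eta> M b n" if "left_module (skew_ring G \<chi> \<eta>) M"
    for M :: "(('g, 'k) skew, 'x, 'y) module_scheme"
    using assms that
    by (intro skew_module_root.intro skew_module.intro skew_module_axioms.intro
        primitive_character.intro primitive_character_axioms.intro) auto
  have q: "q = \<eta> b" by fact
  show ?thesis
  proof (intro conjI allI impI)
    fix V :: "(('g, 'k) skew, 'v, 'd) module_scheme"
    assume V: "simple_left_module (skew_ring G \<chi> \<eta>) V"
      "torsion_free_wrt (skew_ring G \<chi> \<eta>) (elt_y G) V" "torsion_wrt (skew_ring G \<chi> \<eta>) (elt_x G) V"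
    then have "skew_module_root G \<chi> \<eta> V b n" by (intro root) (simp add: simple_left_module_def)
    from simple_module_is_V_y[OF this assms(2) V]
    show "\<exists>\<alpha> \<mu>. \<alpha> \<noteq> 0 \<and> \<mu> \<in> hom (G\<lparr>carrier := kernel G Kx \<eta>\<rparr>) Kx \<and> is_V_y G \<chi> \<eta> b n \<alpha> \<mu> V"
      by blast
  next
    fix \<alpha> \<alpha>' \<mu> \<mu>' and M :: "(('g, 'k) skew, 'w, 'e) module_scheme" and M' :: "(('g, 'k) skew, 'w', 'e') module_scheme"
    assume \<alpha>': "\<alpha>' \<noteq> 0" and VM: "is_V_y G \<chi> \<eta> b n \<alpha> \<mu> M" and VM': "is_V_y G \<chi> \<eta> b n \<alpha>' \<mu>' M'"
    have M: "skew_module_root G \<chi> \<eta> M b n" and M': "skew_module_root G \<chi> \<eta> M' b n"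
      using VM VM' by (auto intro!: root simp: is_V_y_def)
    show "left_modules_isomorphic (skew_ring G \<chi> \<eta>) M M' \<longleftrightarrow>
      (\<forall>h\<in>kernel G Kx \<eta>. \<mu> h = \<mu>' h) \<and> (\<exists>i::nat. \<alpha> = q ^ i * \<alpha>')"
    proof
      assume "left_modules_isomorphic (skew_ring G \<chi> \<eta>) M M'"
      from V_y_parameters_if_isomorphic[OF M M' VM VM' this]
      show "(\<forall>h\<in>kernel G Kx \<eta>. \<mu> h = \<mu>' h) \<and> (\<exists>i::nat. \<alpha> = q ^ i * \<alpha>')" unfolding q .
    next
      assume "(\<forall>h\<in>kernel G Kx \<eta>. \<mu> h = \<mu>' h) \<and> (\<exists>i::nat. \<alpha> = q ^ i * \<alpha>')"
      then obtain i where "\<forall>h\<in>kernel G Kx \<eta>. \<mu> h = \<mu>' h" "\<alpha> = \<eta> b ^ i * \<alpha>'" unfolding q by blast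
      then have "is_V_y G \<chi> \<eta> b n \<alpha> \<mu> M'"
        using skew_module_root.is_V_y_shift[OF M' VM' \<alpha>'] by blast
      then show "left_modules_isomorphic (skew_ring G \<chi> \<eta>) M M'"
        by (rule isomorphic_if_V_y[OF M M' VM])
    qed
  qed
qed

end
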